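(* For any finite Coxeter system $(W,S)$, the Dunkl elements $\theta_s$ ($s\in S$) in the bracket algebra $BE(W,S)$ commute pairwise.
   Context: Let $(W,S)$ be a finite Coxeter system with Coxeter matrix $m(s,s')$. Let $V$ be the real vector space with basis $\{\alpha_s\}_{s\in S}$ and symmetric bilinear form $(\alpha_s,\alpha_{s'})=-\cos(\pi/m(s,s'))$; $W$ acts on $V$ by $s(\lambda)=\lambda-2(\alpha_s,\lambda)\alpha_s$. The root system is $\Delta=\{w(\alpha_s)\}$, $\Delta_+$ the roots with all coordinates $\ge0$ in the basis $\{\alpha_s\}$. If $(W,S)$ is crystallographic, roots are normalized so that $2(\gamma,\gamma')/(\gamma,\gamma)\in\mathbb Z$. $BE(W,S)$ is the associative $\mathbb R$-algebra with generators $[\gamma]$, $\gamma\in\Delta$, and relations: (i) $[-\gamma]=-[\gamma]$; (ii) $[\gamma]^2=0$; (iii) whenever $\gamma_0,\dots,\gamma_{m-1}\in\Delta_+$ ($m\ge2$) are such that $\{\pm\gamma_i\}$ is a root system of type $I_2(m)$ and $\mathbb R_{\ge0}\gamma_i+\mathbb R_{\ge0}\gamma_{i+1}$ meets $\Delta_+$ exactly in $\{\gamma_i,\gamma_{i+1}\}$ for $i=0,\dots,m-2$, then with $\gamma_{j+m}=-\gamma_j$: $\sum_{i=0}^{m-1}[\gamma_i][\gamma_{i+k}]=0$ for each integer $1\le k\le m/2$; (iv) for such $\gamma_0,\dots,\gamma_{m-1}$ with $m\ge4$ and $k=\lfloor m/2\rfloor-1$: $[\gamma_k][\gamma_0]\cdots[\gamma_{2k}]+[\gamma_0]\cdots[\gamma_{2k}][\gamma_k]+[\gamma_k][\gamma_{2k}]\cdots[\gamma_0]+[\gamma_{2k}]\cdots[\gamma_0][\gamma_k]=0$.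 With $\gamma^\vee=2\gamma/(\gamma,\gamma)$ and fundamental weights $\omega_s$ defined by $(\omega_s,\alpha_{s'}^\vee)=\delta_{s,s'}$, the Chevalley elements are $\eta_s=\sum_{\gamma\in\Delta_+}(\omega_s,\gamma^\vee)[\gamma]$ and the Dunkl elements are $\theta_s=\sum_{s'\in S}(\alpha_s,\alpha_{s'})\eta_{s'}$.
   Formalization: All roots are unit vectors, also for crystallographic (W,S); the integrality normalization of roots is dropped, as it conflicts with the given form and, with rescaled roots in type B2, the commutator of the Dunkl elements is a nonzero multiple of [γ_1][γ_3]-[γ_3][γ_1]. *)

theory Defs
  imports
    Complex_Main
    "HOL-Algebra.QuotRing"
    "HOL-Algebra.Module"
    "HOL-Algebra.Generated_Groups"
    "HOL-Algebra.Multiplicative_Group"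
    "HOL-Library.Poly_Mapping"
begin

section \<open>Coxeter systems\<close>

text \<open>\<^const>\<open>group.ord\<close> is 0 on elements of infinite order, so \<open>\<infinity>\<close> is encoded as 0.\<close>

definition coxeter_mat :: "('w, 'r) monoid_scheme \<Rightarrow> 'w \<Rightarrow> 'w \<Rightarrow> nat" where
  "coxeter_mat W s t = group.ord W (s \<otimes>\<^bsub>W\<^esub> t)"

text \<open>The congruence on words over \<open>S\<close> generated by \<open>(s t)\<^sup>m = 1\<close> with \<open>m = m(s, t)\<close>.
  The case \<open>t = s\<close> gives \<open>s s = 1\<close>, so the quotient monoid is already a group, namely the one
  presented by these relations, and words need no formal inverses.\<close>

inductive coxeter_cong :: "('w, 'r) monoid_scheme \<Rightarrow> 'w set \<Rightarrow> 'w list \<Rightarrow> 'w list \<Rightarrow> bool"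
  for W :: "('w, 'r) monoid_scheme" and S :: "'w set" where
  relator: "\<lbrakk>us \<in> lists S; vs \<in> lists S; s \<in> S; t \<in> S; coxeter_mat W s t \<noteq> 0\<rbrakk> \<Longrightarrow>
     coxeter_cong W S (us @ concat (replicate (coxeter_mat W s t) [s, t]) @ vs) (us @ vs)"
| refl: "us \<in> lists S \<Longrightarrow> coxeter_cong W S us us"
| sym: "coxeter_cong W S us vs \<Longrightarrow> coxeter_cong W S vs us"
| trans: "coxeter_cong W S us vs \<Longrightarrow> coxeter_cong W S vs ws \<Longrightarrow> coxeter_cong W S us ws"

text \<open>\<open>W\<close> is generated by the set \<open>S\<close> of elements of order 2, and the relations
  \<open>(s t)\<^sup>m = 1\<close>, \<open>m = m(s, t) < \<infinity>\<close>, form a presentation of \<open>W\<close>.\<close>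

definition coxeter_system :: "('w, 'r) monoid_scheme \<Rightarrow> 'w set \<Rightarrow> bool" where
  "coxeter_system W S \<longleftrightarrow>
     group W \<and> S \<subseteq> carrier W \<and> (\<forall>s\<in>S. group.ord W s = 2) \<and>
     generate W S = carrier W \<and>
     (\<forall>ws\<in>lists S. foldr (\<lambda>s x. s \<otimes>\<^bsub>W\<^esub> x) ws \<one>\<^bsub>W\<^esub> = \<one>\<^bsub>W\<^esub> \<longrightarrow> coxeter_cong W S ws [])"

section \<open>The geometric representation and its roots\<close>

text \<open>\<open>V\<close> consists of the coordinate vectors with respect to the basis of simple roots. They are
  functions on all of \<open>'w\<close>, vanishing outside \<open>S\<close>.\<close>

definition vecs :: "'w set \<Rightarrow> ('w \<Rightarrow> real) set" where
  "vecs S = {v. \<forall>t. t \<notin> S \<longrightarrow> v t = 0}"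

definition simple_root :: "'w \<Rightarrow> 'w \<Rightarrow> real" where
  "simple_root s = (\<lambda>t. if t = s then 1 else 0)"

definition form :: "('w, 'r) monoid_scheme \<Rightarrow> 'w set \<Rightarrow> ('w \<Rightarrow> real) \<Rightarrow> ('w \<Rightarrow> real) \<Rightarrow> real" where
  "form W S u v =
     (\<Sum>s\<in>S. \<Sum>t\<in>S. u s * v t * (- cos (pi / real (coxeter_mat W s t))))"

text \<open>The reflection in \<open>a\<close>, for \<open>(a, a) = 1\<close>.\<close>

definition refl_at :: "('w, 'r) monoid_scheme \<Rightarrow> 'w set \<Rightarrow> ('w \<Rightarrow> real) \<Rightarrow> ('w \<Rightarrow> real) \<Rightarrow> 'w \<Rightarrow> real"
  where "refl_at W S a v = (\<lambda>t. v t - 2 * form W S a v * a t)"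

text \<open>All images of the vectors in \<open>B\<close> under the group generated by the reflections in the
  (unit) vectors of \<open>B\<close>.\<close>

definition refl_orbit :: "('w, 'r) monoid_scheme \<Rightarrow> 'w set \<Rightarrow> ('w \<Rightarrow> real) set \<Rightarrow> ('w \<Rightarrow> real) set" where
  "refl_orbit W S B = {foldr (refl_at W S) as b | as b. as \<in> lists B \<and> b \<in> B}"

text \<open>Words in the simple reflections run through the action of all \<open>w \<in> W\<close>, so this is
  \<open>{w(\<alpha>\<^sub>s)}\<close>. All roots \<open>\<gamma>\<close> have \<open>(\<gamma>, \<gamma>) = 1\<close>, in the crystallographic cases too.
  Rescaling to long and short roots would change the coefficients \<open>(\<omega>\<^sub>s, \<gamma>\<^sup>\<or>)\<close> below but not the
  relations; in type \<open>B\<^sub>2\<close>, with positive roots \<open>\<gamma>\<^sub>0, \<dots>, \<gamma>\<^sub>3\<close>, the relations give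
  \<open>[\<gamma>\<^sub>0][\<gamma>\<^sub>2] - [\<gamma>\<^sub>2][\<gamma>\<^sub>0] + [\<gamma>\<^sub>1][\<gamma>\<^sub>3] - [\<gamma>\<^sub>3][\<gamma>\<^sub>1] = 0\<close> but neither commutator is 0 by itself, and
  the commutator of the rescaled Dunkl elements weights the two differently.\<close>

definition roots :: "('w, 'r) monoid_scheme \<Rightarrow> 'w set \<Rightarrow> ('w \<Rightarrow> real) set" where
  "roots W S = refl_orbit W S (simple_root ` S)"

definition pos_roots :: "('w, 'r) monoid_scheme \<Rightarrow> 'w set \<Rightarrow> ('w \<Rightarrow> real) set" where
  "pos_roots W S = {\<gamma> \<in> roots W S. \<forall>s\<in>S. 0 \<le> \<gamma> s}"

definition coroot :: "('w, 'r) monoid_scheme \<Rightarrow> 'w set \<Rightarrow> ('w \<Rightarrow> real) \<Rightarrow> 'w \<Rightarrow> real" where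
  "coroot W S \<gamma> = (\<lambda>t. 2 * \<gamma> t / form W S \<gamma> \<gamma>)"

definition fund_weight :: "('w, 'r) monoid_scheme \<Rightarrow> 'w set \<Rightarrow> 'w \<Rightarrow> 'w \<Rightarrow> real" where
  "fund_weight W S s = (THE \<omega>. \<omega> \<in> vecs S \<and>
     (\<forall>t\<in>S. form W S \<omega> (coroot W S (simple_root t)) = (if s = t then 1 else 0)))"

text \<open>The same construction as \<^const>\<open>roots\<close>, for the dihedral Coxeter system \<open>I\<^sub>2(m)\<close>: the vectors
  \<open>a\<close>, \<open>b\<close> have the Gram matrix of its simple roots.\<close>

definition dihedral_root_system ::
  "('w, 'r) monoid_scheme \<Rightarrow> 'w set \<Rightarrow> nat \<Rightarrow> ('w \<Rightarrow> real) set \<Rightarrow> bool" where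
  "dihedral_root_system W S m \<Phi> \<longleftrightarrow> m \<ge> 2 \<and>
     (\<exists>a\<in>vecs S. \<exists>b\<in>vecs S. form W S a a = 1 \<and> form W S b b = 1 \<and>
        form W S a b = - cos (pi / real m) \<and> \<Phi> = refl_orbit W S {a, b})"

definition cone2 :: "('w \<Rightarrow> real) \<Rightarrow> ('w \<Rightarrow> real) \<Rightarrow> ('w \<Rightarrow> real) set" where
  "cone2 u v = {(\<lambda>t. x * u t + y * v t) | x y. 0 \<le> x \<and> 0 \<le> y}"

text \<open>Only the values \<open>\<gamma> 0, \<dots>, \<gamma> (m - 1)\<close> matter.\<close>

definition admissible_seq ::
  "('w, 'r) monoid_scheme \<Rightarrow> 'w set \<Rightarrow> nat \<Rightarrow> (nat \<Rightarrow> 'w \<Rightarrow> real) \<Rightarrow> bool" where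
  "admissible_seq W S m \<gamma> \<longleftrightarrow> m \<ge> 2 \<and> (\<forall>i<m. \<gamma> i \<in> pos_roots W S) \<and>
     dihedral_root_system W S m (\<gamma> ` {..<m} \<union> (\<lambda>i. - \<gamma> i) ` {..<m}) \<and>
     (\<forall>i. i + 2 \<le> m \<longrightarrow> cone2 (\<gamma> i) (\<gamma> (i + 1)) \<inter> pos_roots W S = {\<gamma> i, \<gamma> (i + 1)})"

definition ext_seq :: "nat \<Rightarrow> (nat \<Rightarrow> 'w \<Rightarrow> real) \<Rightarrow> nat \<Rightarrow> 'w \<Rightarrow> real" where
  "ext_seq m \<gamma> j = (if even (j div m) then \<gamma> (j mod m) else - \<gamma> (j mod m))"

section \<open>Free associative algebras\<close>

text \<open>The free monoid, written additively because the convolution product of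
  \<^type>\<open>poly_mapping\<close> adds exponents; the addition is not commutative.\<close>

datatype 'a monom = Monom (letters: "'a list")

instantiation monom :: (type) monoid_add
begin
definition "0 = Monom []"
definition "u + v = Monom (letters u @ letters v)"
instance by standard (auto simp: zero_monom_def plus_monom_def)
end

definition free_algebra :: "'a set \<Rightarrow> (real, 'a monom \<Rightarrow>\<^sub>0 real) module" where
  "free_algebra X =
     \<lparr>carrier = {p. \<forall>w\<in>Poly_Mapping.keys p. set (letters w) \<subseteq> X},
      mult = (*), one = 1, zero = 0, add = (+),
      smult = (\<lambda>c p. Poly_Mapping.map (\<lambda>x. c * x) p)\<rparr>"

definition word :: "'a list \<Rightarrow> 'a monom \<Rightarrow>\<^sub>0 real" where
  "word xs = Poly_Mapping.single (Monom xs) 1"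

text \<open>Quotient of an algebra by a two-sided ideal: the ring \<^term>\<open>A Quot I\<close> together with
  \<open>c \<odot> (p + I) = c \<odot> p + I\<close>.\<close>

definition quot_algebra :: "(real, 'b) module \<Rightarrow> 'b set \<Rightarrow> (real, 'b set) module" where
  "quot_algebra A I = ring.extend (A Quot I)
     (module.fields (\<lambda>c P. \<Union>p\<in>P. I +>\<^bsub>A\<^esub> (c \<odot>\<^bsub>A\<^esub> p)))"

section \<open>The bracket algebra\<close>

inductive_set bracket_relators ::
  "('w, 'r) monoid_scheme \<Rightarrow> 'w set \<Rightarrow> (('w \<Rightarrow> real) monom \<Rightarrow>\<^sub>0 real) set"
  for W :: "('w, 'r) monoid_scheme" and S :: "'w set" where
  neg: "\<gamma> \<in> roots W S \<Longrightarrow> word [- \<gamma>] + word [\<gamma>] \<in> bracket_relators W S"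
| square: "\<gamma> \<in> roots W S \<Longrightarrow> word [\<gamma>, \<gamma>] \<in> bracket_relators W S"
| quadratic: "admissible_seq W S m \<gamma> \<Longrightarrow> 1 \<le> k \<Longrightarrow> 2 * k \<le> m \<Longrightarrow>
     (\<Sum>i<m. word [ext_seq m \<gamma> i, ext_seq m \<gamma> (i + k)]) \<in> bracket_relators W S"
| higher: "admissible_seq W S m \<gamma> \<Longrightarrow> m \<ge> 4 \<Longrightarrow> k = m div 2 - 1 \<Longrightarrow>
     word (\<gamma> k # map \<gamma> [0..<2 * k + 1]) + word (map \<gamma> [0..<2 * k + 1] @ [\<gamma> k])
     + word (\<gamma> k # rev (map \<gamma> [0..<2 * k + 1])) + word (rev (map \<gamma> [0..<2 * k + 1]) @ [\<gamma> k])
     \<in> bracket_relators W S"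

definition bracket_ideal ::
  "('w, 'r) monoid_scheme \<Rightarrow> 'w set \<Rightarrow> (('w \<Rightarrow> real) monom \<Rightarrow>\<^sub>0 real) set" where
  "bracket_ideal W S = Idl\<^bsub>free_algebra (roots W S)\<^esub> (bracket_relators W S)"

definition bracket_algebra ::
  "('w, 'r) monoid_scheme \<Rightarrow> 'w set \<Rightarrow> (real, (('w \<Rightarrow> real) monom \<Rightarrow>\<^sub>0 real) set) module" where
  "bracket_algebra W S = quot_algebra (free_algebra (roots W S)) (bracket_ideal W S)"

definition bracket ::
  "('w, 'r) monoid_scheme \<Rightarrow> 'w set \<Rightarrow> ('w \<Rightarrow> real) \<Rightarrow> (('w \<Rightarrow> real) monom \<Rightarrow>\<^sub>0 real) set" where
  "bracket W S \<gamma> = bracket_ideal W S +>\<^bsub>free_algebra (roots W S)\<^esub> word [\<gamma>]"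

definition chevalley ::
  "('w, 'r) monoid_scheme \<Rightarrow> 'w set \<Rightarrow> 'w \<Rightarrow> (('w \<Rightarrow> real) monom \<Rightarrow>\<^sub>0 real) set" where
  "chevalley W S s = (\<Oplus>\<^bsub>bracket_algebra W S\<^esub> \<gamma> \<in> pos_roots W S.
     form W S (fund_weight W S s) (coroot W S \<gamma>) \<odot>\<^bsub>bracket_algebra W S\<^esub> bracket W S \<gamma>)"

definition dunkl ::
  "('w, 'r) monoid_scheme \<Rightarrow> 'w set \<Rightarrow> 'w \<Rightarrow> (('w \<Rightarrow> real) monom \<Rightarrow>\<^sub>0 real) set" where
  "dunkl W S s = (\<Oplus>\<^bsub>bracket_algebra W S\<^esub> t \<in> S.
     form W S (simple_root s) (simple_root t) \<odot>\<^bsub>bracket_algebra W S\<^esub> chevalley W S t)"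

end

theory Submission
  imports Defs
begin

text \<open>Whatever the fundamental weights are, \<open>\<theta>\<^sub>s = \<Sum>\<^sub>\<gamma> (x, \<gamma>) [\<gamma>]\<close> for some vector \<open>x\<close>, so it
  suffices that \<open>\<Sum> ((x, \<gamma>) (y, \<gamma>') - (y, \<gamma>) (x, \<gamma>')) [\<gamma>] [\<gamma>'] = 0\<close>, summed over pairs of positive
  roots. Group the pairs by the plane they span. The positive roots of a plane are unit vectors
  \<open>\<gamma>\<^sub>0, \<dots>, \<gamma>\<^sub>m\<^sub>-\<^sub>1\<close> at angles \<open>i \<pi> / m\<close>, and the coefficient of \<open>[\<gamma>\<^sub>i] [\<gamma>\<^sub>j]\<close> is a constant times
  \<open>sin ((j - i) \<pi> / m)\<close>. Collecting the terms with the same \<open>k \<equiv> j - i\<close> modulo \<open>m\<close> yields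
  \<open>sin (k \<pi> / m)\<close> times the quadratic relation for \<open>k\<close>; for \<open>k > m / 2\<close> this is, up to sign, the
  relation for \<open>m - k\<close> of the reversed sequence.

  That a plane looks like this needs every root to be positive or negative, which is proved with
  the length function on the group generated by the simple reflections. If there are infinitely
  many positive roots, all the sums are 0 by convention, so finiteness need not be proved.\<close>

section \<open>Roots and reflections\<close>

text \<open>One constant for combinations of two vectors turns bilinearity of \<open>form\<close>
  and linearity of reflections into rewrite rules. Multiples of a single vector get a dummy second
  term with coefficient 0.\<close>

definition lincomb :: "real \<Rightarrow> ('w \<Rightarrow> real) \<Rightarrow> real \<Rightarrow> ('w \<Rightarrow> real) \<Rightarrow> 'w \<Rightarrow> real" where
  "lincomb x u y v = (\<lambda>t. x * u t + y * v t)"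

lemma lincomb_apply: "lincomb x u y v t = x * u t + y * v t"
  by (simp add: lincomb_def)

lemma uminus_uminus_fun [simp]: "- (- u) = (u :: 'w \<Rightarrow> real)"
  by (simp add: fun_eq_iff)

lemma uminus_eq_lincomb: "- u = lincomb (-1) u 0 u"
  by (auto simp: fun_eq_iff lincomb_apply)

lemma form_lincomb_left: "form W S (lincomb x u y v) w = x * form W S u w + y * form W S v w"
  by (simp add: form_def lincomb_apply sum_distrib_left sum.distrib[symmetric] algebra_simps)

lemma form_lincomb_right: "form W S w (lincomb x u y v) = x * form W S w u + y * form W S w v"
  by (simp add: form_def lincomb_apply sum_distrib_left sum.distrib[symmetric] algebra_simps)

lemma form_uminus_left: "form W S (- u) w = - form W S u w"
  by (simp add: uminus_eq_lincomb form_lincomb_left)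

lemma refl_at_eq_lincomb: "refl_at W S a v = lincomb 1 v (- 2 * form W S a v) a"
  by (simp add: refl_at_def lincomb_def)

lemma refl_at_lincomb:
  "refl_at W S a (lincomb x u y v) = lincomb x (refl_at W S a u) y (refl_at W S a v)"
  by (auto simp: fun_eq_iff lincomb_apply refl_at_eq_lincomb form_lincomb_right algebra_simps)

lemma refl_at_refl_at: "form W S a a = 1 \<Longrightarrow> refl_at W S a (refl_at W S a v) = v"
  by (auto simp: fun_eq_iff lincomb_apply refl_at_eq_lincomb form_lincomb_right algebra_simps)

lemma refl_at_self: "form W S a a = 1 \<Longrightarrow> refl_at W S a a = - a"
  by (auto simp: fun_eq_iff lincomb_apply refl_at_eq_lincomb)

text \<open>The form and the roots depend on \<open>W\<close> only through its Coxeter matrix, so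
  the argument runs on properties of this matrix. By \<open>mat_ge_2\<close> no entry is the 0 that
  encodes infinite order.\<close>

locale coxeter_matrix =
  fixes W :: "('w, 'r) monoid_scheme" and S :: "'w set"
  assumes finite_generators: "finite S"
    and mat_diag: "s \<in> S \<Longrightarrow> coxeter_mat W s s = 1"
    and mat_ge_2: "s \<in> S \<Longrightarrow> t \<in> S \<Longrightarrow> s \<noteq> t \<Longrightarrow> coxeter_mat W s t \<ge> 2"
    and mat_sym: "s \<in> S \<Longrightarrow> t \<in> S \<Longrightarrow> coxeter_mat W s t = coxeter_mat W t s"
begin

lemma form_sym: "form W S u v = form W S v u"
proof -
  have "form W S u v = (\<Sum>t\<in>S. \<Sum>s\<in>S. u s * v t * (- cos (pi / real (coxeter_mat W s t))))"
    unfolding form_def by (rule sum.swap)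
  also have "\<dots> = form W S v u"
    unfolding form_def by (intro sum.cong HOL.refl) (subst mat_sym, auto)
  finally show ?thesis .
qed

lemma form_simple_root:
  assumes "s \<in> S" "t \<in> S"
  shows "form W S (simple_root s) (simple_root t) = - cos (pi / real (coxeter_mat W s t))"
proof -
  have *: "simple_root s a * simple_root t b * c = (if a = s then if b = t then c else 0 else 0)"
    for a b c
    by (simp add: simple_root_def)
  have "form W S (simple_root s) (simple_root t) =
    (\<Sum>a\<in>S. if a = s then \<Sum>b\<in>S. if b = t then - cos (pi / real (coxeter_mat W s b)) else 0 else 0)"
    unfolding form_def * by (intro sum.cong HOL.refl) auto
  then show ?thesis
    using assms finite_generators by simp
qed

lemma form_simple_root_self [simp]: "s \<in> S \<Longrightarrow> form W S (simple_root s) (simple_root s) = 1"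
  by (simp add: form_simple_root mat_diag)

lemma form_refl_at:
  "form W S a a = 1 \<Longrightarrow> form W S (refl_at W S a u) (refl_at W S a v) = form W S u v"
  by (simp add: refl_at_eq_lincomb form_lincomb_left form_lincomb_right form_sym[of u a] algebra_simps)

text \<open>The reflection in \<open>a\<close> is an isometric involution, so it can be moved from
  \<open>c\<close> to \<open>v\<close> inside the form. Conjugation then transfers closure
  properties from simple reflections to all reflections in roots.\<close>

lemma refl_at_conjugate:
  assumes "form W S a a = 1"
  shows "refl_at W S (refl_at W S a c) v = refl_at W S a (refl_at W S c (refl_at W S a v))"
proof -
  have "form W S (refl_at W S a c) v = form W S c (refl_at W S a v)"
    using form_refl_at[OF assms, of "refl_at W S a c" v] refl_at_refl_at[OF assms] by simp
  moreover have "refl_at W S a (refl_at W S c (refl_at W S a v)) =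
      lincomb 1 (refl_at W S a (refl_at W S a v)) (- 2 * form W S c (refl_at W S a v)) (refl_at W S a c)"
    by (simp only: refl_at_eq_lincomb[of W S c] refl_at_lincomb)
  ultimately show ?thesis
    using refl_at_refl_at[OF assms] refl_at_eq_lincomb[of W S "refl_at W S a c" v] by simp
qed

lemma refl_orbit_step:
  assumes "a \<in> A" "b \<in> refl_orbit W S A"
  shows "refl_at W S a b \<in> refl_orbit W S A"
proof -
  from assms(2) obtain as c where "b = foldr (refl_at W S) as c" "as \<in> lists A" "c \<in> A"
    unfolding refl_orbit_def by blast
  then have "refl_at W S a b = foldr (refl_at W S) (a # as) c" "a # as \<in> lists A" "c \<in> A"
    using assms(1) by auto
  then show ?thesis
    unfolding refl_orbit_def by blast
qed

text \<open>Membership of the intermediate vector in the orbit is carried along, so that the step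
  case may use it.\<close>

lemma refl_orbit_induct [consumes 1, case_names base step]:
  assumes "v \<in> refl_orbit W S A"
    and "\<And>b. b \<in> A \<Longrightarrow> P b"
    and "\<And>a b. a \<in> A \<Longrightarrow> b \<in> refl_orbit W S A \<Longrightarrow> P b \<Longrightarrow> P (refl_at W S a b)"
  shows "P v"
proof -
  obtain as c where v: "v = foldr (refl_at W S) as c" "as \<in> lists A" "c \<in> A"
    using assms(1) unfolding refl_orbit_def by blast
  from v(2) have "P (foldr (refl_at W S) as c) \<and> foldr (refl_at W S) as c \<in> refl_orbit W S A"
  proof (induction as)
    case Nil
    have "c \<in> refl_orbit W S A"
      unfolding refl_orbit_def using v(3) by (auto intro!: exI[of _ "[]"])
    then show ?case
      using assms(2) v(3) by simp
  next
    case (Cons a as)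
    then show ?case
      using assms(3) refl_orbit_step by auto
  qed
  then show ?thesis
    using v(1) by simp
qed

lemma form_root_self: "\<gamma> \<in> roots W S \<Longrightarrow> form W S \<gamma> \<gamma> = 1"
  unfolding roots_def by (induction rule: refl_orbit_induct) (auto simp: form_refl_at)

lemma root_in_vecs: "\<gamma> \<in> roots W S \<Longrightarrow> \<gamma> \<in> vecs S"
  unfolding roots_def
  by (induction rule: refl_orbit_induct)
    (auto simp: vecs_def simple_root_def refl_at_eq_lincomb lincomb_apply split: if_splits)

lemma refl_at_simple_root_in_roots:
  "s \<in> S \<Longrightarrow> \<delta> \<in> roots W S \<Longrightarrow> refl_at W S (simple_root s) \<delta> \<in> roots W S"
  unfolding roots_def by (rule refl_orbit_step) auto

text \<open>Induction on \<gamma>: the reflection in a reflected root is a conjugate by a simple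
  reflection, hence a composite of maps preserving the roots. Here \<delta> stays arbitrary because
  the conjugating reflection moves it.\<close>

lemma refl_at_root_in_roots:
  assumes "\<gamma> \<in> roots W S" "\<delta> \<in> roots W S"
  shows "refl_at W S \<gamma> \<delta> \<in> roots W S"
  using assms(1)[unfolded roots_def] assms(2)
proof (induction arbitrary: \<delta> rule: refl_orbit_induct)
  case (base b)
  then show ?case
    using refl_at_simple_root_in_roots by auto
next
  case (step a b)
  then show ?case
    using refl_at_simple_root_in_roots by (auto simp: refl_at_conjugate)
qed

lemma uminus_root: "\<gamma> \<in> roots W S \<Longrightarrow> - \<gamma> \<in> roots W S"
  using refl_at_root_in_roots[of \<gamma> \<gamma>] refl_at_self[of W S \<gamma>] form_root_self by simp

end

section \<open>Every root is positive or negative\<close>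

text \<open>The alternating word of \<open>k\<close> letters is indexed by its last letter
  \<open>s\<close>, the one that acts first on a vector.\<close>

fun alt_word :: "'a \<Rightarrow> 'a \<Rightarrow> nat \<Rightarrow> 'a list" where
  "alt_word s t 0 = []"
| "alt_word s t (Suc k) = alt_word t s k @ [s]"

lemma length_alt_word [simp]: "length (alt_word s t k) = k"
  by (induction k arbitrary: s t) auto

lemma alt_word_in_lists: "s \<in> A \<Longrightarrow> t \<in> A \<Longrightarrow> alt_word s t k \<in> lists A"
  by (induction k arbitrary: s t) auto

text \<open>The unit vector at angle \<open>j * pi / m\<close> from \<open>u\<close>, when \<open>v\<close> is the one at angle
  \<open>pi - pi / m\<close>.\<close>

definition dihedral_vec :: "nat \<Rightarrow> ('w \<Rightarrow> real) \<Rightarrow> ('w \<Rightarrow> real) \<Rightarrow> nat \<Rightarrow> 'w \<Rightarrow> real" where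
  "dihedral_vec m u v j = lincomb (sin (real (j + 1) * (pi / m)) / sin (pi / m)) u
     (sin (real j * (pi / m)) / sin (pi / m)) v"

lemma sin_pi_div_nonneg: "m \<ge> (1::nat) \<Longrightarrow> k \<le> m \<Longrightarrow> sin (real k * (pi / m)) \<ge> 0"
  by (rule sin_ge_zero) (auto simp: field_simps)

lemma sin_pi_div_pos: "m \<ge> (1::nat) \<Longrightarrow> 0 < k \<Longrightarrow> k < m \<Longrightarrow> sin (real k * (pi / m)) > 0"
  by (rule sin_gt_zero) (auto simp: field_simps)

section \<open>Words in the simple reflections, braid relations and length\<close>

context coxeter_matrix
begin

text \<open>Words stand for elements of the reflection group: two words give the same element when
  their operators \<open>act\<close> agree.\<close>

definition act :: "'w list \<Rightarrow> ('w \<Rightarrow> real) \<Rightarrow> 'w \<Rightarrow> real" where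
  "act ws v = foldr (\<lambda>s. refl_at W S (simple_root s)) ws v"

lemma act_Nil [simp]: "act [] v = v"
  by (simp add: act_def)

lemma act_Cons [simp]: "act (s # ws) v = refl_at W S (simple_root s) (act ws v)"
  by (simp add: act_def)

lemma act_append [simp]: "act (us @ vs) v = act us (act vs v)"
  by (simp add: act_def)

lemma act_lincomb: "act ws (lincomb x u y v) = lincomb x (act ws u) y (act ws v)"
  by (induction ws) (simp_all add: refl_at_lincomb)

lemma act_uminus: "act ws (- v) = - act ws v"
  by (simp add: uminus_eq_lincomb act_lincomb)

lemma refl_at_simple_root_twice [simp]:
  "s \<in> S \<Longrightarrow> refl_at W S (simple_root s) (refl_at W S (simple_root s) v) = v"
  by (simp add: refl_at_refl_at)

lemma refl_at_simple_root_self: "s \<in> S \<Longrightarrow> refl_at W S (simple_root s) (simple_root s) = - simple_root s"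
  by (simp add: refl_at_self)

lemma sin_mat_pos:
  assumes "s \<in> S" "t \<in> S" "s \<noteq> t"
  shows "sin (pi / coxeter_mat W s t) > 0"
  using sin_pi_div_pos[of "coxeter_mat W s t" 1] mat_ge_2[OF assms] by simp

text \<open>Measure angles from one simple root towards the other. Reflecting in
  \<open>simple_root t\<close> reverses the orientation and takes the vector \<open>j\<close> steps
  of \<pi>/m from \<open>simple_root s\<close> to the one \<open>j + 1\<close> steps from
  \<open>simple_root t\<close>.\<close>

lemma refl_at_dihedral_vec:
  assumes "s \<in> S" "t \<in> S" "s \<noteq> t" and m: "m = coxeter_mat W s t"
  shows "refl_at W S (simple_root t) (dihedral_vec m (simple_root s) (simple_root t) j) =
    dihedral_vec m (simple_root t) (simple_root s) (j + 1)"
proof -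
  define \<theta> where "\<theta> = pi / m"
  have \<theta>: "sin \<theta> \<noteq> 0"
    using sin_mat_pos[OF assms(1-3)] m \<theta>_def by simp
  have "form W S (simple_root t) (simple_root s) = - cos \<theta>"
    using assms form_simple_root[of t s] by (simp add: mat_sym \<theta>_def)
  then have "form W S (simple_root t) (dihedral_vec m (simple_root s) (simple_root t) j) =
      (sin (j * \<theta>) - sin ((j + 1) * \<theta>) * cos \<theta>) / sin \<theta>"
    using assms(2) by (simp add: dihedral_vec_def form_lincomb_right \<theta>_def[symmetric] diff_divide_distrib)
  also have "sin (j * \<theta>) = sin ((j + 1) * \<theta>) * cos \<theta> - cos ((j + 1) * \<theta>) * sin \<theta>"
    using sin_diff[of "(j + 1) * \<theta>" \<theta>] by (simp add: algebra_simps)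
  finally have *: "form W S (simple_root t) (dihedral_vec m (simple_root s) (simple_root t) j) =
      - cos ((j + 1) * \<theta>)"
    using \<theta> by simp
  have "sin ((j + 2) * \<theta>) = sin (j * \<theta>) + 2 * cos ((j + 1) * \<theta>) * sin \<theta>"
    using sin_diff[of "(j + 1) * \<theta>" \<theta>] sin_add[of "(j + 1) * \<theta>" \<theta>] by (simp add: algebra_simps)
  then show ?thesis
    using \<theta> unfolding refl_at_eq_lincomb * unfolding dihedral_vec_def \<theta>_def[symmetric]
    by (auto simp: fun_eq_iff lincomb_apply field_simps)
qed

text \<open>Every letter advances the angle by one step and exchanges the roles of the two simple
  roots, whence the parity.\<close>

lemma act_alt_word_dihedral_vec:
  assumes "s \<in> S" "t \<in> S" "s \<noteq> t" "m = coxeter_mat W s t"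
  shows "act (alt_word t s k) (dihedral_vec m (simple_root s) (simple_root t) j) =
    (if even k then dihedral_vec m (simple_root s) (simple_root t) (j + k)
     else dihedral_vec m (simple_root t) (simple_root s) (j + k))"
  using assms
proof (induction k arbitrary: s t j)
  case (Suc k)
  then show ?case
    using Suc.IH[of t s "j + 1"] by (simp add: refl_at_dihedral_vec mat_sym)
qed simp

lemma dihedral_vec_0:
  assumes "s \<in> S" "t \<in> S" "s \<noteq> t" "m = coxeter_mat W s t"
  shows "dihedral_vec m u v 0 = u"
  using sin_mat_pos[OF assms(1-3)] assms(4) by (simp add: dihedral_vec_def fun_eq_iff lincomb_apply)

text \<open>On the left, \<open>m\<close> steps of \<pi>/m end at angle \<pi>. On the right, the
  first reflection negates \<open>simple_root s\<close>, and the other \<open>m - 1\<close> steps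
  lead to angle \<pi> - \<pi>/m, where the other simple root lies. Both sides are the same negated
  simple root.\<close>

lemma act_alt_word_simple_root:
  assumes "s \<in> S" "t \<in> S" "s \<noteq> t" "m = coxeter_mat W s t"
  shows "act (alt_word t s m) (simple_root s) = act (alt_word s t m) (simple_root s)"
proof -
  have sin: "sin (pi / m) > 0" and m2: "m \<ge> 2"
    using sin_mat_pos mat_ge_2 assms by auto
  then obtain k where k: "m = Suc k"
    by (metis Suc_pred' gr0I less_nat_zero_code not_less zero_less_numeral)
  have km: "real k * (pi / m) = pi - pi / m" "real m * (pi / m) = pi" "real (m + 1) * (pi / m) = pi + pi / m"
    using m2 unfolding k by (auto simp: field_simps)
  have vec: "dihedral_vec m u v m = - u" "dihedral_vec m u v k = v" for u v :: "'w \<Rightarrow> real"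
    using sin km k by (auto simp: dihedral_vec_def fun_eq_iff lincomb_apply)
  have 1: "act (alt_word t s m) (simple_root s) = (if even m then - simple_root s else - simple_root t)"
    using act_alt_word_dihedral_vec[OF assms, of m 0] unfolding dihedral_vec_0[OF assms] add_0 vec .
  have 2: "act (alt_word t s k) (simple_root s) = (if even k then simple_root t else simple_root s)"
    using act_alt_word_dihedral_vec[OF assms, of k 0] unfolding dihedral_vec_0[OF assms] add_0 vec .
  have 3: "act (alt_word s t m) (simple_root s) = - act (alt_word t s k) (simple_root s)"
    using assms(1) unfolding k by (simp add: refl_at_simple_root_self act_uminus)
  show ?thesis
    unfolding 1 3 2 by (simp add: k)
qed

lemma act_alt_word_fixed:
  assumes "form W S (simple_root s) v = 0" "form W S (simple_root t) v = 0"
  shows "act (alt_word s t k) v = v"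
proof -
  have "refl_at W S (simple_root s) v = v" "refl_at W S (simple_root t) v = v"
    using assms by (auto simp: refl_at_def)
  then show ?thesis
    by (induction k arbitrary: s t) auto
qed

text \<open>Because the sine of \<pi>/m is positive, the form is nondegenerate on the plane of the
  two simple roots, so \<open>v\<close> splits into a vector \<open>p\<close> of this plane and a
  vector \<open>q\<close> orthogonal to it. Both words fix \<open>q\<close> and agree on the two
  simple roots.\<close>

lemma braid_relation:
  assumes "s \<in> S" "t \<in> S" "s \<noteq> t" "m = coxeter_mat W s t"
  shows "act (alt_word s t m) = act (alt_word t s m)"
proof
  fix v
  define \<theta> where "\<theta> = pi / m"
  define c where "c = cos \<theta>"
  have "sin \<theta> > 0"
    using sin_mat_pos assms \<theta>_def by auto
  then have c: "1 - c\<^sup>2 > 0"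
    unfolding c_def using sin_squared_eq[of \<theta>] by (metis zero_less_power)
  have st: "form W S (simple_root s) (simple_root t) = - c" "form W S (simple_root t) (simple_root s) = - c"
    using assms form_simple_root form_sym by (auto simp: \<theta>_def c_def)
  \<comment> \<open>The coordinates of the orthogonal projection to the plane, by Cramer's rule: the
    Gram matrix of the two simple roots has determinant \<open>1 - c\<^sup>2\<close>.\<close>
  define x where "x = (form W S (simple_root s) v + c * form W S (simple_root t) v) / (1 - c\<^sup>2)"
  define y where "y = (form W S (simple_root t) v + c * form W S (simple_root s) v) / (1 - c\<^sup>2)"
  define p where "p = lincomb x (simple_root s) y (simple_root t)"
  define q where "q = lincomb 1 v (-1) p"
  have xy: "x - c * y = form W S (simple_root s) v" "y - c * x = form W S (simple_root t) v"
  proof -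
    have "x - c * y = form W S (simple_root s) v * (1 - c\<^sup>2) / (1 - c\<^sup>2)"
      "y - c * x = form W S (simple_root t) v * (1 - c\<^sup>2) / (1 - c\<^sup>2)"
      unfolding x_def y_def times_divide_eq_right diff_divide_distrib[symmetric]
      by (simp_all add: algebra_simps power2_eq_square)
    then show "x - c * y = form W S (simple_root s) v" "y - c * x = form W S (simple_root t) v"
      using c by simp_all
  qed
  have "form W S (simple_root s) q = 0" "form W S (simple_root t) q = 0"
    unfolding q_def p_def form_lincomb_right using assms st
    by (simp_all add: algebra_simps flip: xy)
  then have q: "act (alt_word s t m) q = q" "act (alt_word t s m) q = q"
    using act_alt_word_fixed by auto
  have p: "act (alt_word s t m) p = act (alt_word t s m) p"
    unfolding p_def act_lincomb
    using act_alt_word_simple_root[OF assms] act_alt_word_simple_root[of t s m] assms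
    by (simp add: mat_sym)
  have "v = lincomb 1 p 1 q"
    by (auto simp: q_def fun_eq_iff lincomb_apply)
  then show "act (alt_word s t m) v = act (alt_word t s m) v"
    by (simp add: act_lincomb p q)
qed

text \<open>Appending a letter either cancels the last letter of an alternating word or extends it.
  At length \<open>m\<close> the braid relation makes both endings available, so that the letter
  cancels.\<close>

lemma dihedral_word_normal_form:
  assumes "s \<in> S" "t \<in> S" "s \<noteq> t" "m = coxeter_mat W s t" "d \<in> lists {s, t}"
  shows "\<exists>k\<le>m. k \<le> length d \<and> (act d = act (alt_word s t k) \<or> act d = act (alt_word t s k))"
  using assms(5)
proof (induction d rule: rev_induct)
  case Nil
  show ?case
    by (intro exI[of _ 0]) auto
next
  case (snoc x d)
  have step: "\<exists>k\<le>m. k \<le> Suc (length d) \<and>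
      (act (d @ [x]) = act (alt_word x y k) \<or> act (d @ [x]) = act (alt_word y x k))"
    if xy: "x \<in> S" "y \<in> S" "x \<noteq> y" "m = coxeter_mat W x y"
      and k: "k \<le> m" "k \<le> length d" "act d = act (alt_word x y k) \<or> act d = act (alt_word y x k)"
    for x y k
  \<comment> \<open>The case in which the alternating word can be chosen to end in
    \<open>x\<close>.\<close>
  proof (cases "act d = act (alt_word x y k) \<and> k > 0 \<or> k = m")
    case True
    have "m > 0"
      using mat_ge_2 xy by force
    then have "k > 0" "act d = act (alt_word x y k)"
      using True k braid_relation[OF xy] by auto
    then obtain l where "k = Suc l" "act d = act (alt_word y x l @ [x])"
      by (cases k) auto
    then have "act (d @ [x]) = act (alt_word y x l)"
      using xy by (simp add: fun_eq_iff)
    then show ?thesis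
      using k \<open>k = Suc l\<close> by (intro exI[of _ l]) auto
  next
    case False
    then have "act d = act (alt_word y x k)" "k < m"
      using k by auto
    then have "act (d @ [x]) = act (alt_word x y (Suc k))"
      by (auto simp: fun_eq_iff)
    then show ?thesis
      using k \<open>k < m\<close> by (intro exI[of _ "Suc k"]) auto
  qed
  from snoc obtain k where
    k: "k \<le> m" "k \<le> length d" "act d = act (alt_word s t k) \<or> act d = act (alt_word t s k)"
    by auto
  have "x = s \<or> x = t"
    using snoc by auto
  then show ?case
  proof
    assume "x = s"
    then show ?case
      using step[OF assms(1-4) k] by (simp only: length_append_singleton)
  next
    assume "x = t"
    moreover have "m = coxeter_mat W t s"
      using assms by (simp add: mat_sym)
    ultimately show ?case
      using step[of t s k] assms(1-3) k by (simp only: length_append_singleton) blast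
  qed
qed

text \<open>If the normal form of \<open>d\<close> can end in \<open>s\<close>, appending
  \<open>s\<close> shortens it. Otherwise it ends in \<open>t\<close> (or is empty) and has
  \<open>k < m\<close> letters, so it turns \<open>simple_root s\<close> by \<open>k\<close> steps.
  The coordinates are then sines of at most \<open>m\<close> steps over a positive sine.\<close>

lemma dihedral_word_simple_root:
  assumes "s \<in> S" "t \<in> S" "s \<noteq> t" "d \<in> lists {s, t}"
  shows "(\<exists>d'\<in>lists {s, t}. length d' < length d \<and> act d' = act (d @ [s])) \<or>
    (\<exists>x\<ge>0. \<exists>y\<ge>0. act d (simple_root s) = lincomb x (simple_root s) y (simple_root t))"
proof -
  define m where "m = coxeter_mat W s t"
  note st = assms(1-3) m_def
  have m2: "m \<ge> 2"
    using mat_ge_2 st by auto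
  obtain k where k: "k \<le> m" "k \<le> length d" "act d = act (alt_word s t k) \<or> act d = act (alt_word t s k)"
    using dihedral_word_normal_form[OF st assms(4)] by auto
  show ?thesis
  proof (cases "act d = act (alt_word s t k) \<and> k > 0 \<or> k = m")
    case True
    then have "k > 0" "act d = act (alt_word s t k)"
      using k braid_relation[OF st] m2 by auto
    then obtain l where l: "k = Suc l" "act d = act (alt_word t s l @ [s])"
      by (cases k) auto
    then have "act (d @ [s]) = act (alt_word t s l)"
      using assms by (simp add: fun_eq_iff)
    then show ?thesis
      using l k alt_word_in_lists[of t "{s, t}" s l] by (intro disjI1 bexI[of _ "alt_word t s l"]) auto
  next
    case False
    then have d: "act d = act (alt_word t s k)" and km: "k < m"
      using k by auto
    have pos: "sin (pi / m) > 0" "sin (real k * (pi / m)) \<ge> 0" "sin (real (k + 1) * (pi / m)) \<ge> 0"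
      using sin_mat_pos st sin_pi_div_nonneg[of m k] sin_pi_div_nonneg[of m "k + 1"] km by auto
    have "act d (simple_root s) = (if even k then dihedral_vec m (simple_root s) (simple_root t) k
        else dihedral_vec m (simple_root t) (simple_root s) k)"
      using act_alt_word_dihedral_vec[OF st, of k 0] by (simp add: dihedral_vec_0[OF st] d)
    moreover have "dihedral_vec m (simple_root t) (simple_root s) k =
        lincomb (sin (real k * (pi / m)) / sin (pi / m)) (simple_root s)
          (sin (real (k + 1) * (pi / m)) / sin (pi / m)) (simple_root t)"
      by (auto simp: fun_eq_iff lincomb_apply dihedral_vec_def)
    ultimately have "\<exists>x y. x \<ge> 0 \<and> y \<ge> 0 \<and>
        act d (simple_root s) = lincomb x (simple_root s) y (simple_root t)"
      using divide_nonneg_pos[OF pos(2,1)] divide_nonneg_pos[OF pos(3,1)]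
      by (cases "even k") (auto simp: dihedral_vec_def simp del: of_nat_add)
    then show ?thesis
      by blast
  qed
qed

text \<open>The length of the group element rather than of the list: it depends on \<open>ws\<close>
  only through \<open>act ws\<close>.\<close>

definition len :: "'w list \<Rightarrow> nat" where
  "len ws = (LEAST n. \<exists>us\<in>lists S. length us = n \<and> act us = act ws)"

lemma len_le: "us \<in> lists S \<Longrightarrow> act us = act ws \<Longrightarrow> len ws \<le> length us"
  unfolding len_def by (rule Least_le) auto

lemma len_witness:
  assumes "ws \<in> lists S"
  obtains us where "us \<in> lists S" "length us = len ws" "act us = act ws"
proof -
  have "\<exists>n. \<exists>us\<in>lists S. length us = n \<and> act us = act ws"
    using assms by blast
  then have "\<exists>us\<in>lists S. length us = len ws \<and> act us = act ws"
    unfolding len_def by (rule LeastI_ex)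
  then show thesis
    using that by blast
qed

text \<open>Split a reduced word for \<open>w\<close> as \<open>v d\<close> with \<open>v\<close> shortest possible and \<open>d\<close> in the dihedral
  subgroup of \<open>s\<close> and the last letter \<open>t\<close>. Then \<open>v\<close> sends both simple roots to nonnegative vectors
  by induction, and \<open>d\<close> sends \<open>simple_root s\<close> into the cone they span.\<close>

lemma act_simple_root_nonneg:
  assumes "ws \<in> lists S" "s \<in> S" "len ws \<le> len (ws @ [s])" "u \<in> S"
  shows "act ws (simple_root s) u \<ge> 0"
  using assms(1-3)
proof (induction "len ws" arbitrary: ws s rule: less_induct)
  case less
  obtain rs where rs: "rs \<in> lists S" "length rs = len ws" "act rs = act ws"
    using len_witness less.prems by blast
  show ?case
  proof (cases rs rule: rev_cases)
    case Nil
    then have "act ws (simple_root s) = simple_root s"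
      by (simp flip: rs(3))
    then show ?thesis
      by (simp add: simple_root_def)
  next
    case (snoc rs' t)
    have t: "t \<in> S" "rs' \<in> lists S"
      using snoc rs by auto
    \<comment> \<open>If the reduced word ended in \<open>s\<close>, dropping that letter would give
      a word for \<open>ws @ [s]\<close> shorter than \<open>len ws\<close>.\<close>
    have "s \<noteq> t"
    proof
      assume "s = t"
      then have "act rs' = act (ws @ [s])"
        using snoc less.prems by (simp add: fun_eq_iff flip: rs(3))
      then show False
        using len_le[of rs' "ws @ [s]"] t less.prems rs snoc by auto
    qed
    \<comment> \<open>The left factors of length-additive factorizations of \<open>ws\<close>. The
      prefix \<open>rs'\<close> is one of them, with \<open>d = [t]\<close>.\<close>
    define split where "split v \<longleftrightarrow> v \<in> lists S \<and>
      (\<exists>d\<in>lists {s, t}. act (v @ d) = act ws \<and> length v + length d = len ws)" for v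
    have "split rs'"
      unfolding split_def using t rs snoc by (auto intro!: bexI[of _ "[t]"])
    then obtain v where v: "split v" "\<And>v'. split v' \<Longrightarrow> length v \<le> length v'"
      using ex_has_least_nat[of split rs' length] by blast
    then obtain d where d: "d \<in> lists {s, t}" "act (v @ d) = act ws" "length v + length d = len ws" "v \<in> lists S"
      unfolding split_def by blast
    have dS: "lists {s, t} \<subseteq> lists S"
      using less.prems t by (intro lists_mono) auto
    have "length v < len ws"
      using v(2)[OF \<open>split rs'\<close>] rs snoc by simp
    then have lenv: "len v < len ws"
      using len_le[of v v] d by simp
    have vx: "act v (simple_root x) u \<ge> 0" if x: "x \<in> {s, t}" for x
    proof (rule less.hyps[OF lenv \<open>v \<in> lists S\<close>])
      show "x \<in> S"
        using x less.prems t by auto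
      show "len v \<le> len (v @ [x])"
      proof (rule ccontr)
        \<comment> \<open>Otherwise \<open>x\<close> can be moved from \<open>v\<close> to
          \<open>d\<close>: a reduced word for \<open>v @ [x]\<close>, followed by
          \<open>x # d\<close>, is again a length-additive factorization, against the minimality of
          \<open>v\<close>.\<close>
        assume "\<not> len v \<le> len (v @ [x])"
        then have lt: "len (v @ [x]) < length v"
          using len_le[of v v] d by simp
        obtain v' where v': "v' \<in> lists S" "length v' = len (v @ [x])" "act v' = act (v @ [x])"
          using len_witness[of "v @ [x]"] d \<open>x \<in> S\<close> by auto
        have eq: "act (v' @ (x # d)) = act ws"
          using \<open>x \<in> S\<close> v'(3) by (simp add: fun_eq_iff flip: d(2))
        have xd: "x # d \<in> lists {s, t}"
          using d x by auto
        then have "len ws \<le> length (v' @ (x # d))"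
          using v'(1) d(1) \<open>x \<in> S\<close> dS eq by (intro len_le) (auto simp del: act_append act_Cons)
        then have "length v' + length (x # d) = len ws"
          using lt v' d by auto
        then have "split v'"
          unfolding split_def using v' eq xd by blast
        then show False
          using v(2) v' lt by fastforce
      qed
    qed
    \<comment> \<open>A replacement of \<open>d @ [s]\<close> shorter than \<open>d\<close> would
      make \<open>ws @ [s]\<close> shorter than \<open>ws\<close>.\<close>
    have "\<not> (\<exists>d'\<in>lists {s, t}. length d' < length d \<and> act d' = act (d @ [s]))"
    proof
      assume "\<exists>d'\<in>lists {s, t}. length d' < length d \<and> act d' = act (d @ [s])"
      then obtain d' where d': "d' \<in> lists {s, t}" "length d' < length d" "act d' = act (d @ [s])"
        by blast
      have "act (v @ d') = act (ws @ [s])"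
        by (rule ext) (simp add: d'(3) flip: d(2))
      then have "len (ws @ [s]) \<le> length (v @ d')"
        using d d' dS by (intro len_le) auto
      then show False
        using d d' less.prems by simp
    qed
    then obtain x y where xy: "x \<ge> 0" "y \<ge> 0"
        "act d (simple_root s) = lincomb x (simple_root s) y (simple_root t)"
      using dihedral_word_simple_root[OF less.prems(2) t(1) \<open>s \<noteq> t\<close> d(1)] by blast
    have "act ws (simple_root s) = lincomb x (act v (simple_root s)) y (act v (simple_root t))"
      using d xy by (simp add: act_lincomb flip: d(2))
    then show ?thesis
      using xy vx by (simp add: lincomb_apply)
  qed
qed

text \<open>Write \<gamma> as the image of \<open>simple_root s\<close> under \<open>ws\<close>. If
  \<open>s\<close> does not shorten \<open>ws\<close>, the root is nonnegative. Otherwise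
  \<open>s\<close> does not shorten \<open>ws @ [s]\<close>, which sends
  \<open>simple_root s\<close> to the negative of \<gamma>.\<close>

lemma root_pos_or_neg:
  assumes "\<gamma> \<in> roots W S"
  shows "\<gamma> \<in> pos_roots W S \<or> - \<gamma> \<in> pos_roots W S"
proof -
  have "\<exists>ws s. \<gamma> = act ws (simple_root s) \<and> ws \<in> lists S \<and> s \<in> S"
    using assms unfolding roots_def
  proof (induction rule: refl_orbit_induct)
    case (base b)
    then show ?case
      by (auto intro!: exI[of _ "[]"])
  next
    case (step a b)
    then obtain r ws s where r: "r \<in> S" "a = simple_root r" "b = act ws (simple_root s)" "ws \<in> lists S" "s \<in> S"
      by blast
    then have "refl_at W S a b = act (r # ws) (simple_root s)"
      by (simp add: act_def)
    then show ?case
      using r by fastforce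
  qed
  then obtain ws s where ws: "\<gamma> = act ws (simple_root s)" "ws \<in> lists S" "s \<in> S"
    by blast
  show ?thesis
  proof (cases "len ws \<le> len (ws @ [s])")
    case True
    then show ?thesis
      using act_simple_root_nonneg ws assms by (auto simp: pos_roots_def)
  next
    case False
    have "act ((ws @ [s]) @ [s]) = act ws"
      using ws by (simp add: fun_eq_iff)
    then have "len ((ws @ [s]) @ [s]) = len ws"
      by (simp add: len_def)
    then have "\<And>u. u \<in> S \<Longrightarrow> act (ws @ [s]) (simple_root s) u \<ge> 0"
      using act_simple_root_nonneg[of "ws @ [s]" s] ws False by simp
    moreover have "act (ws @ [s]) (simple_root s) = - \<gamma>"
      using ws by (simp add: refl_at_simple_root_self act_uminus)
    ultimately show ?thesis
      using uminus_root[OF assms] by (auto simp: pos_roots_def)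
  qed
qed

lemma uminus_pos_root:
  assumes "\<gamma> \<in> pos_roots W S"
  shows "- \<gamma> \<notin> pos_roots W S"
proof
  assume "- \<gamma> \<in> pos_roots W S"
  then have "\<forall>s\<in>S. \<gamma> s = 0"
    using assms by (force simp: pos_roots_def)
  then have "form W S \<gamma> \<gamma> = 0"
    by (simp add: form_def)
  then show False
    using assms form_root_self by (auto simp: pos_roots_def)
qed

end

section \<open>Roots in a plane\<close>

text \<open>Finiteness gives a least positive element \<delta>. Reflecting repeatedly produces all
  its multiples, and an element strictly between two multiples could be moved to one between 0 and
  \<delta>. As \<open>a\<close> is itself a multiple, it determines \<open>m\<close>.\<close>

lemma reflection_closed_angles:
  fixes \<Theta> :: "real set"
  assumes zero: "0 \<in> \<Theta>" and a: "a \<in> \<Theta>" "a > 0" and fin: "finite (\<Theta> \<inter> {0<..a})"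
    and refl: "\<And>\<phi> \<psi>. \<phi> \<in> \<Theta> \<Longrightarrow> \<psi> \<in> \<Theta> \<Longrightarrow> 2 * \<phi> - \<psi> \<in> \<Theta>"
  obtains m :: nat where "m \<ge> 1" "\<Theta> = range (\<lambda>k::int. of_int k * (a / real m))"
proof -
  define \<delta> where "\<delta> = Min (\<Theta> \<inter> {0<..a})"
  have "\<Theta> \<inter> {0<..a} \<noteq> {}"
    using a by auto
  from Min_in[OF fin this] have \<delta>: "\<delta> \<in> \<Theta>" "\<delta> > 0" "\<delta> \<le> a"
    by (auto simp: \<delta>_def)
  have min: False if "r \<in> \<Theta>" "0 < r" "r < \<delta>" for r
  proof -
    have "\<delta> \<le> r"
      unfolding \<delta>_def using that \<delta> by (intro Min_le[OF fin]) auto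
    then show False
      using that by simp
  qed
  have neg: "- \<phi> \<in> \<Theta>" if "\<phi> \<in> \<Theta>" for \<phi>
    using refl[OF zero that] by simp
  have nat: "real n * \<delta> \<in> \<Theta> \<and> real (Suc n) * \<delta> \<in> \<Theta>" for n
  proof (induction n)
    case (Suc n)
    then show ?case
      using refl[of "real (Suc n) * \<delta>" "real n * \<delta>"] by (simp add: algebra_simps)
  qed (use zero \<delta> in auto)
  have int: "of_int k * \<delta> \<in> \<Theta>" for k :: int
  proof (cases "k \<ge> 0")
    case True
    then show ?thesis
      using nat[of "nat k"] by simp
  next
    case False
    then show ?thesis
      using neg[OF conjunct1[OF nat[of "nat (- k)"]]] by simp
  qed
  have mult: "\<exists>k::int. \<phi> = of_int k * \<delta>" if \<phi>: "\<phi> \<in> \<Theta>" for \<phi>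
  proof (rule ccontr)
    assume not: "\<nexists>k::int. \<phi> = of_int k * \<delta>"
    define k where "k = \<lfloor>\<phi> / \<delta>\<rfloor>"
    have "of_int k \<le> \<phi> / \<delta>" "\<phi> / \<delta> < of_int k + 1"
      unfolding k_def by linarith+
    then have "of_int k * \<delta> \<le> \<phi>" "\<phi> < of_int k * \<delta> + \<delta>"
      using \<delta> by (auto simp: field_simps)
    with not have k: "of_int k * \<delta> < \<phi>" "\<phi> < of_int k * \<delta> + \<delta>"
      by (auto simp: order_less_le)
    show False
    \<comment> \<open>A reflection followed by negation shifts by an even number of steps, which
      brings \<phi> below \<delta> when \<open>k\<close> is even. For odd \<open>k\<close> a single
      reflection yields the distance from \<phi> up to the multiple \<open>k + 1\<close>.\<close>
    proof (cases "even k")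
      case True
      then obtain j where "k = 2 * j" ..
      then show False
        using min[of "\<phi> - of_int k * \<delta>"] neg[OF refl[OF int[of j] \<phi>]] k by (simp add: algebra_simps)
    next
      case False
      then obtain j where "k = 2 * j + 1" ..
      then show False
        using min[of "of_int k * \<delta> + \<delta> - \<phi>"] refl[OF int[of "j + 1"] \<phi>] k by (simp add: algebra_simps)
    qed
  qed
  obtain k :: int where k: "a = of_int k * \<delta>"
    using mult a by auto
  then have "k > 0"
    using a \<delta> by (simp add: zero_less_mult_iff)
  then have \<delta>_eq: "\<delta> = a / real (nat k)" and "nat k \<ge> 1"
    using k by auto
  moreover have "\<Theta> = range (\<lambda>k::int. of_int k * \<delta>)"
    using int mult by blast
  ultimately show thesis
    using that[of "nat k"] by simp
qed

text \<open>For orthonormal \<open>p\<close>, \<open>q\<close> this is the unit vector at angle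
  \<phi> in their plane, counted from \<open>p\<close> towards \<open>q\<close>.\<close>

definition circ :: "('w \<Rightarrow> real) \<Rightarrow> ('w \<Rightarrow> real) \<Rightarrow> real \<Rightarrow> 'w \<Rightarrow> real" where
  "circ p q \<phi> = lincomb (cos \<phi>) p (sin \<phi>) q"

lemma circ_0 [simp]: "circ p q 0 = p"
  by (simp add: circ_def fun_eq_iff lincomb_apply)

lemma circ_add_pi: "circ p q (\<phi> + pi) = - circ p q \<phi>"
  by (simp add: circ_def fun_eq_iff lincomb_apply)

lemma circ_add_int_pi: "circ p q (\<phi> + pi * of_int k) = (if even k then circ p q \<phi> else - circ p q \<phi>)"
  by (simp add: circ_def fun_eq_iff lincomb_apply cos_add sin_add cos_npi_int)

lemma circ_rotate: "circ (circ p q \<phi>) (circ p q (\<phi> + pi / 2)) \<psi> = circ p q (\<phi> + \<psi>)"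
  by (simp add: circ_def fun_eq_iff lincomb_apply cos_add sin_add algebra_simps)

text \<open>This writes the vector at \<psi> through those at \<alpha> and \<beta>. For \<psi>
  between angles less than \<pi> apart the coefficients are nonnegative, so nonnegativity of
  coordinates passes to the vectors in between.\<close>

lemma circ_between:
  "lincomb (sin (\<beta> - \<psi>)) (circ p q \<alpha>) (sin (\<psi> - \<alpha>)) (circ p q \<beta>) =
    lincomb (sin (\<beta> - \<alpha>)) (circ p q \<psi>) 0 p"
proof -
  have *: "sin (\<beta> - \<psi>) * cos \<alpha> + sin (\<psi> - \<alpha>) * cos \<beta> = sin (\<beta> - \<alpha>) * cos \<psi> * 1"
    "sin (\<beta> - \<psi>) * sin \<alpha> + sin (\<psi> - \<alpha>) * sin \<beta> = sin (\<beta> - \<alpha>) * sin \<psi> * 1"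
    unfolding sin_cos_squared_add[of \<psi>, symmetric] sin_cos_squared_add[of \<alpha>, symmetric]
    by (simp_all add: sin_diff cos_diff algebra_simps power2_eq_square)
  show ?thesis
  proof
    fix t
    have "lincomb (sin (\<beta> - \<psi>)) (circ p q \<alpha>) (sin (\<psi> - \<alpha>)) (circ p q \<beta>) t =
      (sin (\<beta> - \<psi>) * cos \<alpha> + sin (\<psi> - \<alpha>) * cos \<beta>) * p t +
      (sin (\<beta> - \<psi>) * sin \<alpha> + sin (\<psi> - \<alpha>) * sin \<beta>) * q t"
      by (simp add: circ_def lincomb_apply algebra_simps)
    then show "lincomb (sin (\<beta> - \<psi>)) (circ p q \<alpha>) (sin (\<psi> - \<alpha>)) (circ p q \<beta>) t =
      lincomb (sin (\<beta> - \<alpha>)) (circ p q \<psi>) 0 p t"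
      unfolding * by (simp add: circ_def lincomb_apply algebra_simps)
  qed
qed

text \<open>Chebyshev polynomials of the second kind with a shifted index: \<open>U\<^sub>n\<^sub>-\<^sub>1(c)\<close>.\<close>

fun cheb :: "real \<Rightarrow> nat \<Rightarrow> real" where
  "cheb c 0 = 0"
| "cheb c (Suc 0) = 1"
| "cheb c (Suc (Suc n)) = 2 * c * cheb c (Suc n) - cheb c n"

text \<open>The recursion doubles the absolute value at least and subtracts the previous one at
  most, so the increments of the absolute values never decrease; the first one is 1.\<close>

lemma cheb_growth:
  assumes "\<bar>c\<bar> \<ge> 1"
  shows "\<bar>cheb c n\<bar> + 1 \<le> \<bar>cheb c (Suc n)\<bar>"
proof (induction n)
  case (Suc n)
  have "2 * \<bar>cheb c (Suc n)\<bar> \<le> \<bar>2 * c * cheb c (Suc n)\<bar>"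
    using assms by (simp add: abs_mult mult_right_mono)
  also have "\<dots> \<le> \<bar>cheb c (Suc (Suc n))\<bar> + \<bar>cheb c n\<bar>"
    by simp
  finally show ?case
    using Suc by simp
qed simp

section \<open>Orthonormal coordinates and the angles of the roots in a plane\<close>

context coxeter_matrix
begin

definition orthonormal :: "('w \<Rightarrow> real) \<Rightarrow> ('w \<Rightarrow> real) \<Rightarrow> bool" where
  "orthonormal p q \<longleftrightarrow> form W S p p = 1 \<and> form W S q q = 1 \<and> form W S p q = 0"

lemma form_circ: "orthonormal p q \<Longrightarrow> form W S (circ p q \<phi>) (circ p q \<psi>) = cos (\<phi> - \<psi>)"
  by (simp add: orthonormal_def circ_def form_lincomb_left form_lincomb_right form_sym[of q p] cos_diff)

lemma orthonormal_circ: "orthonormal p q \<Longrightarrow> orthonormal (circ p q \<phi>) (circ p q (\<phi> + pi / 2))"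
  by (simp add: orthonormal_def[of "circ p q \<phi>"] form_circ)

text \<open>The mirror is the line at angle \<phi> + \<pi>/2, about which \<psi> is
  reflected.\<close>

lemma refl_at_circ:
  assumes "orthonormal p q"
  shows "refl_at W S (circ p q \<phi>) (circ p q \<psi>) = circ p q (2 * \<phi> - \<psi> + pi)"
proof -
  define d where "d = \<phi> - \<psi>"
  have \<psi>: "\<psi> = \<phi> - d" "2 * \<phi> - \<psi> = \<phi> + d"
    by (auto simp: d_def)
  show ?thesis
    unfolding circ_add_pi refl_at_eq_lincomb form_circ[OF assms] d_def[symmetric] \<psi>(2)
    unfolding \<psi>(1)
    by (simp add: circ_def fun_eq_iff lincomb_apply cos_add sin_add cos_diff sin_diff algebra_simps)
qed

text \<open>A linear relation would make one root a multiple of the other, and for unit vectors the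
  factor could only be 1 or -1.\<close>

lemma roots_independent:
  assumes u: "u \<in> roots W S" and v: "v \<in> roots W S" and "u \<noteq> v" "u \<noteq> - v"
    and eq: "lincomb x u y v = lincomb x' u y' v"
  shows "x = x' \<and> y = y'"
proof -
  define a b where "a = x - x'" and "b = y' - y"
  have ab: "a * u t = b * v t" for t
    using fun_cong[OF eq, of t] by (simp add: a_def b_def lincomb_apply algebra_simps)
  have "a = 0"
  proof (rule ccontr)
    assume "a \<noteq> 0"
    then have u_eq: "u = lincomb (b / a) v 0 v"
      using ab by (auto simp: fun_eq_iff lincomb_apply field_simps)
    have "form W S u u = (b / a)\<^sup>2 * form W S v v"
      by (subst (1 2) u_eq) (simp add: form_lincomb_left form_lincomb_right power2_eq_square)
    then have "b / a = 1 \<or> b / a = -1"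
      using u v by (simp add: form_root_self power2_eq_1_iff)
    moreover have "lincomb 1 v 0 v = v"
      by (simp add: fun_eq_iff lincomb_apply)
    ultimately show False
      using u_eq assms(3,4) uminus_eq_lincomb[of v] by metis
  qed
  moreover have "b = 0"
  proof (rule ccontr)
    assume "b \<noteq> 0"
    then have "\<And>t. v t = 0"
      using ab \<open>a = 0\<close> by simp
    then have "form W S v v = 0"
      by (simp add: form_def)
    then show False
      using v by (simp add: form_root_self)
  qed
  ultimately show ?thesis
    by (simp add: a_def b_def)
qed

text \<open>If \<open>\<bar>c\<bar> \<ge> 1\<close>, the two reflections generate infinitely many roots
  \<open>w\<^sub>0 = v\<close>, \<open>w\<^sub>1 = 2 c v - u\<close>, \<open>w\<^sub>n\<^sub>+\<^sub>2 = 2 c w\<^sub>n\<^sub>+\<^sub>1 - w\<^sub>n\<close>.\<close>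

lemma abs_form_roots_less_1:
  assumes fin: "finite (roots W S)"
    and u: "u \<in> roots W S" and v: "v \<in> roots W S" and ne: "u \<noteq> v" "u \<noteq> - v"
  shows "\<bar>form W S u v\<bar> < 1"
proof (rule ccontr)
  define c where "c = form W S u v"
  assume "\<not> \<bar>form W S u v\<bar> < 1"
  then have growth: "\<bar>cheb c n\<bar> + 1 \<le> \<bar>cheb c (Suc n)\<bar>" for n
    by (intro cheb_growth) (simp add: c_def)
  define w where "w n = lincomb (- cheb c n) u (cheb c (Suc n)) v" for n
  have w_Suc: "w (Suc (Suc n)) = - refl_at W S (w (Suc n)) (w n)"
    if "form W S (w (Suc n)) (w n) = c" for n
    unfolding refl_at_eq_lincomb that by (simp add: w_def fun_eq_iff lincomb_apply algebra_simps)
  have w0: "w 0 = v" "w (Suc 0) = - refl_at W S v u"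
    by (auto simp: w_def refl_at_eq_lincomb c_def form_sym[of u v] fun_eq_iff lincomb_apply)
  \<comment> \<open>The constant product of consecutive vectors is part of the induction, since it
    is what turns each reflection into a step of the recursion.\<close>
  have "w n \<in> roots W S \<and> w (Suc n) \<in> roots W S \<and> form W S (w (Suc n)) (w n) = c" for n
  proof (induction n)
    case 0
    have "w (Suc 0) \<in> roots W S"
      unfolding w0 by (intro uminus_root refl_at_root_in_roots u v)
    moreover have "form W S (w (Suc 0)) (w 0) = c"
      unfolding w0 form_uminus_left refl_at_eq_lincomb form_lincomb_left
      by (simp add: form_root_self v c_def form_sym[of v u])
    ultimately show ?case
      using v by (simp add: w0(1))
  next
    case (Suc n)
    then have "w (Suc (Suc n)) = - refl_at W S (w (Suc n)) (w n)"
      using w_Suc by blast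
    moreover have "- refl_at W S (w (Suc n)) (w n) \<in> roots W S"
      using Suc by (intro uminus_root refl_at_root_in_roots) auto
    moreover have "form W S (- refl_at W S (w (Suc n)) (w n)) (w (Suc n)) = c"
      unfolding form_uminus_left refl_at_eq_lincomb form_lincomb_left
      using Suc by (simp add: form_root_self form_sym[of "w n" "w (Suc n)"])
    ultimately have "w (Suc (Suc n)) \<in> roots W S" "form W S (w (Suc (Suc n))) (w (Suc n)) = c"
      by (simp_all only:)
    then show ?case
      using Suc by blast
  qed
  then have "range w \<subseteq> roots W S"
    by auto
  moreover have "inj w"
  proof (rule injI)
    have "strict_mono (\<lambda>n. \<bar>cheb c n\<bar>)"
      unfolding strict_mono_Suc_iff
    proof
      show "\<bar>cheb c n\<bar> < \<bar>cheb c (Suc n)\<bar>" for n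
        using growth[of n] by simp
    qed
    moreover fix k l assume "w k = w l"
    then have "cheb c k = cheb c l"
      using roots_independent[OF u v ne, of "- cheb c k" _ "- cheb c l"] unfolding w_def by simp
    ultimately show "k = l"
      using strict_mono_eq[of "\<lambda>n. \<bar>cheb c n\<bar>" k l] by simp
  qed
  ultimately show False
    using fin finite_subset range_inj_infinite by blast
qed

lemma finite_roots: "finite (pos_roots W S) \<Longrightarrow> finite (roots W S)"
proof (rule finite_subset)
  show "roots W S \<subseteq> pos_roots W S \<union> uminus ` pos_roots W S"
  proof
    fix \<gamma> assume "\<gamma> \<in> roots W S"
    then show "\<gamma> \<in> pos_roots W S \<union> uminus ` pos_roots W S"
      using root_pos_or_neg[of \<gamma>] image_eqI[of \<gamma> uminus "- \<gamma>" "pos_roots W S"]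
      by (simp only: uminus_uminus_fun Un_iff) blast
  qed
qed auto

lemma pos_roots_subset: "\<gamma> \<in> pos_roots W S \<Longrightarrow> \<gamma> \<in> roots W S"
  by (simp add: pos_roots_def)

text \<open>As the product of \<open>u\<close> and \<open>v\<close> lies strictly between -1 and 1,
  they yield an orthonormal basis. The angles of the roots are closed under reflection and finite in
  number up to \<pi>, so they are the multiples of some \<pi>/m.\<close>

lemma plane_roots:
  assumes fin: "finite (pos_roots W S)"
    and u: "u \<in> pos_roots W S" and v: "v \<in> pos_roots W S" and "u \<noteq> v"
  obtains m p q where "m \<ge> 2" "orthonormal p q" "u = p"
    "{lincomb x u y v |x y. True} = {lincomb x p y q |x y. True}"
    "roots W S \<inter> {lincomb x u y v |x y. True} = range (\<lambda>k::int. circ p q (of_int k * (pi / real m)))"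
proof -
  have roots: "u \<in> roots W S" "v \<in> roots W S" and ne: "u \<noteq> - v"
    using u v uminus_pos_root pos_roots_subset by auto
  define c where "c = form W S u v"
  have "\<bar>c\<bar> < 1"
    unfolding c_def using abs_form_roots_less_1 finite_roots fin roots assms ne by blast
  then have "c\<^sup>2 < 1"
    by (simp add: abs_square_less_1)
  define r where "r = sqrt (1 - c\<^sup>2)"
  have r: "r > 0" "r\<^sup>2 = 1 - c\<^sup>2"
    using \<open>c\<^sup>2 < 1\<close> by (auto simp: r_def)
  \<comment> \<open>Gram-Schmidt: \<open>v\<close> minus its projection to \<open>u\<close>, divided
    by its norm \<open>r\<close>.\<close>
  define q where "q = lincomb (- c / r) u (1 / r) v"
  have "form W S u q = 0"
    unfolding q_def form_lincomb_right by (simp add: form_root_self roots c_def[symmetric])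
  moreover have "form W S q q = (1 - c\<^sup>2) / r\<^sup>2"
    unfolding q_def form_lincomb_right form_lincomb_left using r(1)
    by (simp add: form_root_self roots form_sym[of v u] c_def[symmetric] field_simps power2_eq_square)
  ultimately have on: "orthonormal u q"
    using r \<open>c\<^sup>2 < 1\<close> by (simp add: orthonormal_def form_root_self roots)
  have "lincomb x u y v = lincomb (x + c * y) u (r * y) q" for x y
    using r by (auto simp: fun_eq_iff lincomb_apply q_def field_simps)
  moreover have "lincomb x u y q = lincomb (x - c * y / r) u (y / r) v" for x y
    using r by (auto simp: fun_eq_iff lincomb_apply q_def field_simps)
  ultimately have span: "{lincomb x u y v |x y. True} = {lincomb x u y q |x y. True}"
    by blast
  define \<Theta> where "\<Theta> = {\<phi>. circ u q \<phi> \<in> roots W S}"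
  have eq: "roots W S \<inter> {lincomb x u y v |x y. True} = circ u q ` \<Theta>"
  proof
    show "circ u q ` \<Theta> \<subseteq> roots W S \<inter> {lincomb x u y v |x y. True}"
      unfolding span by (auto simp: \<Theta>_def circ_def)
    show "roots W S \<inter> {lincomb x u y v |x y. True} \<subseteq> circ u q ` \<Theta>"
      unfolding span
    proof safe
      fix x y assume root: "lincomb x u y q \<in> roots W S"
      have "form W S (lincomb x u y q) (lincomb x u y q) = x\<^sup>2 + y\<^sup>2"
        using on by (simp add: orthonormal_def form_lincomb_left form_lincomb_right
          form_sym[of q u] power2_eq_square)
      then have "x\<^sup>2 + y\<^sup>2 = 1"
        using form_root_self[OF root] by simp
      then obtain \<phi> where "x = cos \<phi>" "y = sin \<phi>"
        using sincos_total_2pi by metis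
      then show "lincomb x u y q \<in> circ u q ` \<Theta>"
        using root by (auto simp: \<Theta>_def circ_def)
    qed
  qed
  have \<Theta>: "0 \<in> \<Theta>" "pi \<in> \<Theta>"
    using roots circ_add_pi[of u q 0] uminus_root by (auto simp: \<Theta>_def)
  \<comment> \<open>Negating the reflected root removes the summand \<pi> of
    \<open>refl_at_circ\<close>.\<close>
  have refl: "2 * \<phi> - \<psi> \<in> \<Theta>" if "\<phi> \<in> \<Theta>" "\<psi> \<in> \<Theta>" for \<phi> \<psi>
    using uminus_root[OF refl_at_root_in_roots[of "circ u q \<phi>" "circ u q \<psi>"]] that
    by (simp add: \<Theta>_def refl_at_circ[OF on] circ_add_pi)
  have "finite (\<Theta> \<inter> {0<..pi})"
  proof (rule inj_on_finite[of "circ u q"])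
    show "inj_on (circ u q) (\<Theta> \<inter> {0<..pi})"
    proof (rule inj_onI)
      fix \<phi> \<psi> assume "\<phi> \<in> \<Theta> \<inter> {0<..pi}" "\<psi> \<in> \<Theta> \<inter> {0<..pi}" "circ u q \<phi> = circ u q \<psi>"
      moreover from this have "cos \<phi> = cos \<psi>"
        using form_circ[OF on, of \<phi> 0] form_circ[OF on, of \<psi> 0] by simp
      ultimately show "\<phi> = \<psi>"
        using cos_inj_pi by auto
    qed
    show "circ u q ` (\<Theta> \<inter> {0<..pi}) \<subseteq> roots W S"
      by (auto simp: \<Theta>_def)
  qed (rule finite_roots[OF fin])
  then obtain m :: nat where m: "m \<ge> 1" "\<Theta> = range (\<lambda>k::int. of_int k * (pi / real m))"
    using reflection_closed_angles[OF \<Theta> pi_gt_zero _ refl] by blast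
  \<comment> \<open>With \<open>m = 1\<close> the plane would contain only \<open>u\<close> and its
    negative, but it also contains \<open>v\<close>.\<close>
  have "m \<noteq> 1"
  proof
    assume "m = 1"
    have "v = lincomb 0 u 1 v"
      by (simp add: fun_eq_iff lincomb_apply)
    then have "v \<in> circ u q ` \<Theta>"
      unfolding eq[symmetric] using roots by blast
    then obtain k :: int where "v = circ u q (0 + pi * of_int k)"
      unfolding m \<open>m = 1\<close> by (auto simp: mult.commute)
    then have "v = u \<or> v = - u"
      unfolding circ_add_int_pi by (auto split: if_splits)
    then show False
      using assms ne by auto
  qed
  then show thesis
    using that[of m u q] m on span eq by (simp add: image_image)
qed

lemma circ_int_cases:
  fixes k :: int
  assumes "m \<ge> (1::nat)"
  obtains j where "j < m" "circ p q (of_int k * (pi / real m)) = circ p q (real j * (pi / real m)) \<or>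
    circ p q (of_int k * (pi / real m)) = - circ p q (real j * (pi / real m))"
proof -
  define j where "j = nat (k mod int m)"
  have j: "j < m" "int j = k mod int m"
    using assms by (auto simp: j_def nat_less_iff)
  have "real_of_int k = real_of_int (int m * (k div int m) + k mod int m)"
    by simp
  also have "\<dots> = real m * real_of_int (k div int m) + real j"
    by (simp add: j(2)[symmetric])
  finally have "of_int k * (pi / real m) = real j * (pi / real m) + pi * of_int (k div int m)"
    using assms by (simp add: field_simps)
  then show thesis
    using that[OF j(1)] by (simp add: circ_add_int_pi)
qed

text \<open>The first and the last vector enclose the angle \<pi> - \<pi>/m and serve as simple
  roots. The product of their reflections is a rotation by two steps, which from
  \<open>\<gamma> 0\<close> and \<open>\<gamma> 1\<close> reaches all even and odd indices.
  Conversely, both reflections preserve the multiples of \<pi>/m.\<close>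

lemma dihedral_root_system_circ:
  assumes "m \<ge> 2" "orthonormal p q" and vecs: "\<And>\<phi>. circ p q \<phi> \<in> vecs S"
  defines "\<gamma> \<equiv> \<lambda>j. circ p q (real j * (pi / real m))"
  shows "dihedral_root_system W S m (\<gamma> ` {..<m} \<union> (\<lambda>i. - \<gamma> i) ` {..<m})"
proof -
  define \<delta> where "\<delta> = pi / real m"
  have m\<delta>: "real m * \<delta> = pi"
    using assms(1) by (simp add: \<delta>_def)
  define a b where "a = \<gamma> 0" and "b = \<gamma> (m - 1)"
  have "real (m - 1) * (pi / real m) = real m * \<delta> - \<delta>"
    using assms(1) by (simp add: \<delta>_def of_nat_diff field_simps)
  then have b: "b = circ p q (real m * \<delta> - \<delta>)"
    by (simp only: b_def \<gamma>_def)
  have a: "a = circ p q 0"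
    by (simp add: a_def \<gamma>_def)
  have "2 * 0 - x * \<delta> + pi = (real m - x) * \<delta>" for x
    unfolding m\<delta>[symmetric] by (simp add: algebra_simps)
  then have refl_a: "refl_at W S a (circ p q (x * \<delta>)) = circ p q ((real m - x) * \<delta>)" for x
    unfolding a refl_at_circ[OF assms(2)] by simp
  have "2 * (real m * \<delta> - \<delta>) - x * \<delta> + pi = (3 * real m - 2 - x) * \<delta>" for x
    unfolding m\<delta>[symmetric] by (simp add: algebra_simps)
  then have refl_b: "refl_at W S b (circ p q (x * \<delta>)) = circ p q ((3 * real m - 2 - x) * \<delta>)" for x
    unfolding b refl_at_circ[OF assms(2)] by simp
  let ?\<Phi> = "\<gamma> ` {..<m} \<union> (\<lambda>i. - \<gamma> i) ` {..<m}"
  have "?\<Phi> = refl_orbit W S {a, b}"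
  proof
    \<comment> \<open>The two reflections together add two steps and subtract a full turn of
      \<open>2 * m\<close> steps.\<close>
    have step: "\<gamma> (Suc (Suc j)) \<in> refl_orbit W S {a, b}" if "\<gamma> j \<in> refl_orbit W S {a, b}" for j
    proof -
      have "(real m - (3 * real m - 2 - real j)) * \<delta> = real (j + 2) * \<delta> + real m * \<delta> * of_int (- 2)"
        by (simp add: algebra_simps)
      then have "refl_at W S a (refl_at W S b (\<gamma> j)) = circ p q (real (j + 2) * \<delta> + pi * of_int (- 2))"
        unfolding \<gamma>_def \<delta>_def[symmetric] refl_a refl_b m\<delta> by (rule arg_cong)
      also have "\<dots> = \<gamma> (Suc (Suc j))"
        unfolding circ_add_int_pi by (simp add: \<gamma>_def \<delta>_def)
      finally show ?thesis
        using that refl_orbit_step by (metis insertCI)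
    qed
    have ab: "a \<in> refl_orbit W S {a, b}" "b \<in> refl_orbit W S {a, b}"
      unfolding refl_orbit_def by (auto intro!: exI[of _ "[]"])
    have "(real m - 1) * \<delta> = real m * \<delta> - \<delta>" "(real m - (real m - 1)) * \<delta> = real (Suc 0) * (pi / real m)"
      by (simp add: left_diff_distrib, simp add: \<delta>_def)
    then have "refl_at W S a b = \<gamma> (Suc 0)"
      using refl_a[of "real m - 1"] unfolding b \<gamma>_def by (simp only:)
    then have "\<gamma> j \<in> refl_orbit W S {a, b} \<and> \<gamma> (Suc j) \<in> refl_orbit W S {a, b}" for j
      using step ab refl_orbit_step[of a "{a, b}" b] by (induction j) (auto simp: a_def)
    moreover have "- \<gamma> j = \<gamma> (j + m)" for j
      unfolding \<gamma>_def \<delta>_def[symmetric] by (simp add: distrib_right m\<delta> circ_add_pi)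
    ultimately show "?\<Phi> \<subseteq> refl_orbit W S {a, b}"
      by auto
    show "refl_orbit W S {a, b} \<subseteq> ?\<Phi>"
    proof
      fix v assume "v \<in> refl_orbit W S {a, b}"
      then have "\<exists>k::int. v = circ p q (of_int k * \<delta>)"
      proof (induction rule: refl_orbit_induct)
        case (base v)
        have "a = circ p q (of_int 0 * \<delta>)" "b = circ p q (of_int (int m - 1) * \<delta>)"
          by (auto simp: a b left_diff_distrib)
        then show ?case
          using base by blast
      next
        case (step c v)
        then obtain k :: int where k: "v = circ p q (of_int k * \<delta>)"
          by blast
        have "refl_at W S a v = circ p q (of_int (int m - k) * \<delta>)"
          "refl_at W S b v = circ p q (of_int (3 * int m - 2 - k) * \<delta>)"
          unfolding k refl_a refl_b by simp_all
        then show ?case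
          using step(1) by blast
      qed
      then obtain k :: int where "v = circ p q (of_int k * \<delta>)" ..
      then show "v \<in> ?\<Phi>"
        using circ_int_cases[of m p q k] assms(1) unfolding \<delta>_def[symmetric] \<gamma>_def by fastforce
    qed
  qed
  moreover have "form W S a a = 1" "form W S b b = 1"
    unfolding a b form_circ[OF assms(2)] by simp_all
  moreover have "form W S a b = - cos (pi / real m)"
    unfolding a b form_circ[OF assms(2)] m\<delta> by (simp add: \<delta>_def)
  moreover have "a \<in> vecs S" "b \<in> vecs S"
    unfolding a b by (rule vecs)+
  ultimately show ?thesis
    unfolding dihedral_root_system_def using assms(1) by blast
qed

text \<open>A positive root in the cone of two neighbours lies in the plane, so it is some
  \<open>\<gamma> k\<close>. Nonnegativity of its cone coefficients fixes the signs of two sines,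
  which leaves only the two neighbours.\<close>

lemma admissible_seq_circ:
  assumes "m \<ge> 2" "orthonormal p q"
  defines "\<gamma> \<equiv> \<lambda>j. circ p q (real j * (pi / real m))"
  assumes pos: "pos_roots W S \<inter> {lincomb x p y q |x y. True} = \<gamma> ` {..<m}"
    and vecs: "\<And>\<phi>. circ p q \<phi> \<in> vecs S"
  shows "admissible_seq W S m \<gamma>"
proof -
  define \<delta> where "\<delta> = pi / real m"
  have sin_pos: "sin (real k * \<delta>) > 0" if "0 < k" "k < m" for k
    unfolding \<delta>_def by (rule sin_pi_div_pos) (use that in auto)
  have cone: "cone2 (\<gamma> i) (\<gamma> (i + 1)) \<inter> pos_roots W S = {\<gamma> i, \<gamma> (i + 1)}" if i: "i + 2 \<le> m" for i
  proof
    have "\<gamma> i \<in> cone2 (\<gamma> i) (\<gamma> (i + 1))"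
      unfolding cone2_def by (rule CollectI, rule exI[of _ 1], rule exI[of _ 0]) simp
    moreover have "\<gamma> (i + 1) \<in> cone2 (\<gamma> i) (\<gamma> (i + 1))"
      unfolding cone2_def by (rule CollectI, rule exI[of _ 0], rule exI[of _ 1]) simp
    ultimately show "{\<gamma> i, \<gamma> (i + 1)} \<subseteq> cone2 (\<gamma> i) (\<gamma> (i + 1)) \<inter> pos_roots W S"
      using i pos by auto
    show "cone2 (\<gamma> i) (\<gamma> (i + 1)) \<inter> pos_roots W S \<subseteq> {\<gamma> i, \<gamma> (i + 1)}"
    proof
      fix w assume w: "w \<in> cone2 (\<gamma> i) (\<gamma> (i + 1)) \<inter> pos_roots W S"
      then obtain x y where xy: "x \<ge> 0" "y \<ge> 0" "w = lincomb x (\<gamma> i) y (\<gamma> (i + 1))"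
        unfolding cone2_def lincomb_def by blast
      moreover have "\<exists>x' y'. w = lincomb x' p y' q"
        unfolding xy \<gamma>_def circ_def
        by (rule exI[of _ "x * cos (i * (pi / m)) + y * cos (real (i + 1) * (pi / m))"],
            rule exI[of _ "x * sin (i * (pi / m)) + y * sin (real (i + 1) * (pi / m))"])
          (simp add: fun_eq_iff lincomb_apply algebra_simps)
      ultimately have "w \<in> \<gamma> ` {..<m}"
        using w unfolding pos[symmetric] by blast
      then obtain k where k: "k < m" "w = \<gamma> k"
        by auto
      have form_w: "form W S w (circ p q \<phi>) = x * cos (i * \<delta> - \<phi>) + y * cos (i * \<delta> + \<delta> - \<phi>)"
        "form W S w (circ p q \<phi>) = cos (k * \<delta> - \<phi>)" for \<phi>
        subgoal
          unfolding xy(3) form_lincomb_left \<gamma>_def form_circ[OF assms(2)]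
          by (simp add: \<delta>_def distrib_right add_divide_distrib add.commute)
        subgoal
          unfolding k(2) \<gamma>_def form_circ[OF assms(2)] by (simp add: \<delta>_def)
        done
      have cos_sin: "cos (\<phi> - (\<psi> + pi / 2)) = sin (\<phi> - \<psi>)" for \<phi> \<psi> :: real
        by (simp add: cos_diff sin_diff cos_add sin_add)
      \<comment> \<open>Pairing with a vector perpendicular to one neighbour isolates the
        coefficient of the other.\<close>
      have "sin (k * \<delta> - i * \<delta>) = y * sin \<delta>"
        using form_w[of "i * \<delta> + pi / 2"] unfolding cos_sin by simp
      moreover have "sin (k * \<delta> - (i * \<delta> + \<delta>)) = - x * sin \<delta>"
        using form_w[of "i * \<delta> + \<delta> + pi / 2"] unfolding cos_sin by simp
      moreover have "sin \<delta> > 0"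
        using sin_pos[of 1] assms(1) by simp
      ultimately have s: "sin (k * \<delta> - i * \<delta>) \<ge> 0" "sin (k * \<delta> - (i * \<delta> + \<delta>)) \<le> 0"
        using xy by auto
      have "\<not> k < i"
      proof
        assume "k < i"
        then have "sin (real (i - k) * \<delta>) > 0"
          using i by (intro sin_pos) auto
        moreover have "real (i - k) * \<delta> = - (k * \<delta> - i * \<delta>)"
          using \<open>k < i\<close> by (simp add: of_nat_diff algebra_simps)
        ultimately show False
          using s(1) by (simp only: sin_minus)
      qed
      moreover have "\<not> i + 1 < k"
      proof
        assume "i + 1 < k"
        then have "sin (real (k - (i + 1)) * \<delta>) > 0"
          using k by (intro sin_pos) auto
        moreover have "real (k - (i + 1)) * \<delta> = k * \<delta> - (i * \<delta> + \<delta>)"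
          using \<open>i + 1 < k\<close> by (simp add: of_nat_diff algebra_simps)
        ultimately show False
          using s(2) by simp
      qed
      ultimately have "k = i \<or> k = i + 1"
        by linarith
      then show "w \<in> {\<gamma> i, \<gamma> (i + 1)}"
        using k by auto
    qed
  qed
  have "\<gamma> i \<in> pos_roots W S" if "i < m" for i
    using that pos by auto
  then show ?thesis
    unfolding admissible_seq_def
    using assms(1) cone dihedral_root_system_circ[OF assms(1,2) vecs] by (auto simp: \<gamma>_def)
qed

text \<open>Go back from \<open>u\<close> in steps of \<pi>/m up to the last positive root, at index
  \<open>1 - K\<close>. The next root back, at \<open>- K\<close>, is negative, so its opposite at
  \<open>m - K\<close> is positive. Roots between \<open>u\<close> and this one are nonnegative
  combinations of them. This gives \<open>m\<close> consecutive positive roots, and the other roots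
  of the plane are their negatives.\<close>

lemma plane_pos_roots:
  assumes fin: "finite (pos_roots W S)"
    and u: "u \<in> pos_roots W S" and v: "v \<in> pos_roots W S" and "u \<noteq> v"
  obtains m p q where "m \<ge> 2" "orthonormal p q"
    "pos_roots W S \<inter> {lincomb x u y v |x y. True} = (\<lambda>j. circ p q (real j * (pi / real m))) ` {..<m}"
    "admissible_seq W S m (\<lambda>j. circ p q (real j * (pi / real m)))"
proof -
  obtain m p q where m: "m \<ge> 2" and on: "orthonormal p q" and p: "u = p"
    and span: "{lincomb x u y v |x y. True} = {lincomb x p y q |x y. True}"
    and plane: "roots W S \<inter> {lincomb x u y v |x y. True} =
      range (\<lambda>k::int. circ p q (of_int k * (pi / real m)))"
    by (rule plane_roots[OF assms])
  define \<delta> where "\<delta> = pi / real m"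
  have m\<delta>: "real m * \<delta> = pi"
    using m by (simp add: \<delta>_def)
  define T where "T k = circ p q (of_int k * \<delta>)" for k :: int
  have T_root: "T k \<in> roots W S" for k
    using plane unfolding T_def \<delta>_def by blast
  have T_m: "T (k + int m) = - T k" for k
    unfolding T_def by (simp add: distrib_right m\<delta> circ_add_pi)
  \<comment> \<open>Half a turn back from \<open>u\<close> lies its negative.\<close>
  have "\<exists>n. T (- int n) \<notin> pos_roots W S"
    using T_m[of "- int m"] u uminus_pos_root[of "T (- int m)"]
    by (intro exI[of _ m]) (auto simp: T_def p)
  then obtain K where K: "T (- int K) \<notin> pos_roots W S" "\<And>n. n < K \<Longrightarrow> T (- int n) \<in> pos_roots W S"
    using exists_least_iff[of "\<lambda>n. T (- int n) \<notin> pos_roots W S"] by blast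
  have "K \<noteq> 0"
  proof
    assume "K = 0"
    then show False
      using K(1) u by (simp add: T_def p)
  qed
  have TM: "T (int m - int K) \<in> pos_roots W S"
    using T_m[of "- int K"] root_pos_or_neg[OF T_root, of "- int K"] K by simp
  have T_pos: "T (1 - int K + int j) \<in> pos_roots W S" if "j < m" for j
  proof (cases "j < K")
    case True
    then have eq: "1 - int K + int j = - int (K - 1 - j)" and "K - 1 - j < K"
      by auto
    from K(2)[OF this(2)] show ?thesis
      unfolding eq .
  next
    case False
    define l where "l = j + 1 - K"
    define M where "M = m - K"
    have l: "1 - int K + int j = int l" "int m - int K = int M" "l \<le> M" "M < m" "0 < M"
      using False that \<open>K \<noteq> 0\<close> by (auto simp: l_def M_def)
    have sin: "sin (real M * \<delta>) > 0" "sin (real (M - l) * \<delta>) \<ge> 0" "sin (real l * \<delta>) \<ge> 0"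
      using sin_pi_div_pos[of m M] sin_pi_div_nonneg[of m "M - l"] sin_pi_div_nonneg[of m l] l m
      by (auto simp: \<delta>_def)
    have "lincomb (sin (real (M - l) * \<delta>)) (T 0) (sin (real l * \<delta>)) (T (int M)) =
        lincomb (sin (real M * \<delta>)) (T (int l)) 0 p"
      using circ_between[of "real M * \<delta>" "real l * \<delta>" p q 0] l
      by (simp add: T_def of_nat_diff left_diff_distrib)
    then have "sin (real M * \<delta>) * T (int l) t =
        sin (real (M - l) * \<delta>) * T 0 t + sin (real l * \<delta>) * T (int M) t" for t
      by (metis (no_types) add.right_neutral lincomb_apply mult_zero_left)
    moreover have "T 0 t \<ge> 0" "T (int M) t \<ge> 0" if "t \<in> S" for t
      using u TM that l(2) by (auto simp: pos_roots_def T_def p)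
    ultimately have "T (int l) t \<ge> 0" if "t \<in> S" for t
      using sin that by (metis add_nonneg_nonneg mult_nonneg_nonneg zero_le_mult_iff not_less)
    then show ?thesis
      unfolding l using T_root by (simp add: pos_roots_def)
  qed
  \<comment> \<open>Rotate the basis so that counting starts at the first positive root.\<close>
  define \<phi> where "\<phi> = of_int (1 - int K) * \<delta>"
  define p' q' where "p' = circ p q \<phi>" and "q' = circ p q (\<phi> + pi / 2)"
  have on': "orthonormal p' q'"
    unfolding p'_def q'_def by (rule orthonormal_circ[OF on])
  have circ': "circ p' q' (of_int k * \<delta>) = T (1 - int K + k)" for k
    by (simp add: p'_def q'_def circ_rotate \<phi>_def T_def distrib_right)
  have circ_j: "circ p' q' (real j * (pi / real m)) = T (1 - int K + int j)" for j
    using circ'[of "int j"] by (simp add: \<delta>_def)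
  have pos: "pos_roots W S \<inter> {lincomb x u y v |x y. True} =
      (\<lambda>j. circ p' q' (real j * (pi / real m))) ` {..<m}"
  proof
    show "(\<lambda>j. circ p' q' (real j * (pi / real m))) ` {..<m} \<subseteq>
        pos_roots W S \<inter> {lincomb x u y v |x y. True}"
      using T_pos plane unfolding circ_j T_def \<delta>_def by blast
    show "pos_roots W S \<inter> {lincomb x u y v |x y. True} \<subseteq>
        (\<lambda>j. circ p' q' (real j * (pi / real m))) ` {..<m}"
    proof
      fix w assume w: "w \<in> pos_roots W S \<inter> {lincomb x u y v |x y. True}"
      then obtain k where "w = T k"
        using plane pos_roots_subset unfolding T_def \<delta>_def by blast
      then have "w = circ p' q' (of_int (k - 1 + int K) * (pi / real m))"
        using circ'[of "k - 1 + int K"] by (simp add: \<delta>_def)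
      moreover obtain j where "j < m"
        "circ p' q' (of_int (k - 1 + int K) * (pi / real m)) = circ p' q' (real j * (pi / real m)) \<or>
         circ p' q' (of_int (k - 1 + int K) * (pi / real m)) = - circ p' q' (real j * (pi / real m))"
        using circ_int_cases[of m p' q' "k - 1 + int K"] m by auto
      ultimately have j: "j < m" "w = circ p' q' (real j * (pi / real m)) \<or>
          w = - circ p' q' (real j * (pi / real m))"
        by auto
      moreover have "w \<noteq> - circ p' q' (real j * (pi / real m))"
        using uminus_pos_root[OF T_pos[OF j(1)]] w unfolding circ_j by blast
      ultimately show "w \<in> (\<lambda>j. circ p' q' (real j * (pi / real m))) ` {..<m}"
        by blast
    qed
  qed
  have span': "{lincomb x u y v |x y. True} = {lincomb x p' y q' |x y. True}"
  proof -
    have "lincomb x p y q = lincomb (x * cos \<phi> + y * sin \<phi>) p' (y * cos \<phi> - x * sin \<phi>) q'" for x y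
    proof
      fix t
      have "lincomb (x * cos \<phi> + y * sin \<phi>) p' (y * cos \<phi> - x * sin \<phi>) q' t =
          x * ((sin \<phi>)\<^sup>2 + (cos \<phi>)\<^sup>2) * p t + y * ((sin \<phi>)\<^sup>2 + (cos \<phi>)\<^sup>2) * q t"
        by (simp add: p'_def q'_def circ_def lincomb_apply cos_add sin_add power2_eq_square algebra_simps
            del: sin_cos_squared_add sin_cos_squared_add2 sin_cos_squared_add3)
      then show "lincomb x p y q t =
          lincomb (x * cos \<phi> + y * sin \<phi>) p' (y * cos \<phi> - x * sin \<phi>) q' t"
        by (simp add: lincomb_apply)
    qed
    moreover have "lincomb x p' y q' = lincomb (x * cos \<phi> - y * sin \<phi>) p (x * sin \<phi> + y * cos \<phi>) q" for x y
      by (simp add: p'_def q'_def circ_def fun_eq_iff lincomb_apply cos_add sin_add algebra_simps)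
    ultimately show ?thesis
      unfolding span by blast
  qed
  have "p \<in> vecs S" "v \<in> vecs S"
    using u v p root_in_vecs pos_roots_subset by auto
  then have "{lincomb x u y v |x y. True} \<subseteq> vecs S"
    by (auto simp: vecs_def p lincomb_apply)
  then have "circ p' q' \<psi> \<in> vecs S" for \<psi>
    unfolding span' circ_def by blast
  then have "admissible_seq W S m (\<lambda>j. circ p' q' (real j * (pi / real m)))"
    using admissible_seq_circ[OF m on'] pos unfolding span' by blast
  then show thesis
    using that m on' pos by blast
qed

end

section \<open>Ideals of free algebras\<close>

text \<open>Scalars act as constant polynomials, so the rules for them follow from the ring
  laws.\<close>

definition scale :: "real \<Rightarrow> ('a monom \<Rightarrow>\<^sub>0 real) \<Rightarrow> 'a monom \<Rightarrow>\<^sub>0 real" where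
  "scale c p = Poly_Mapping.single 0 c * p"

lemma smult_free_algebra: "c \<odot>\<^bsub>free_algebra X\<^esub> p = scale c p"
  by (simp add: free_algebra_def scale_def mult_map_scale_conv_mult)

lemma scale_add_right: "scale c (p + q) = scale c p + scale c q"
  by (simp add: scale_def algebra_simps)

lemma scale_diff_right: "scale c (p - q) = scale c p - scale c q"
  by (simp add: scale_def algebra_simps)

lemma scale_add_left: "scale (c + d) p = scale c p + scale d p"
  by (simp add: scale_def single_add algebra_simps)

lemma scale_diff_left: "scale (c - d) p = scale c p - scale d p"
  by (simp add: scale_def single_diff algebra_simps)

lemma scale_scale: "scale c (scale d p) = scale (c * d) p"
  by (simp add: scale_def mult_single flip: mult.assoc)

lemma scale_0_left [simp]: "scale 0 p = 0"
  by (simp add: scale_def)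

lemma scale_1 [simp]: "scale 1 p = p"
  by (simp add: scale_def)

lemma scale_minus_left: "scale (- c) p = - scale c p"
  using scale_diff_left[of 0 c p] by simp

lemma scale_sum_right: "scale c (\<Sum>i\<in>A. f i) = (\<Sum>i\<in>A. scale c (f i))"
  by (simp add: scale_def sum_distrib_left)

lemma scale_sum_left: "scale (\<Sum>i\<in>A. c i) p = (\<Sum>i\<in>A. scale (c i) p)"
  by (induction A rule: infinite_finite_induct) (simp_all add: scale_add_left)

lemma word_append: "word (xs @ ys) = word xs * word ys"
  by (simp add: word_def mult_single plus_monom_def)

lemma scale_word: "scale c (word xs) = Poly_Mapping.single (Monom xs) c"
  by (simp add: scale_def word_def mult_single)

lemma scale_word_mult: "scale c (word xs) * scale d (word ys) = scale (c * d) (word (xs @ ys))"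
  by (simp add: scale_word mult_single plus_monom_def)

lemma scale_in_free_algebra:
  assumes "p \<in> carrier (free_algebra X)"
  shows "scale c p \<in> carrier (free_algebra X)"
proof -
  have "Poly_Mapping.keys (scale c p) \<subseteq> Poly_Mapping.keys p"
    using keys_mult[of "Poly_Mapping.single 0 c" p] by (auto simp: scale_def split: if_splits)
  then show ?thesis
    using assms by (auto simp: free_algebra_def)
qed

lemma word_in_free_algebra: "set xs \<subseteq> X \<Longrightarrow> word xs \<in> carrier (free_algebra X)"
  by (simp add: free_algebra_def word_def)

lemma zero_free_algebra: "\<zero>\<^bsub>free_algebra X\<^esub> = 0"
  by (simp add: free_algebra_def)

lemma add_free_algebra: "p \<oplus>\<^bsub>free_algebra X\<^esub> q = p + q"
  by (simp add: free_algebra_def)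

lemma ring_free_algebra: "ring (free_algebra X)"
proof (rule ringI)
  show "abelian_group (free_algebra X)"
  proof (rule abelian_groupI)
    fix p assume p: "p \<in> carrier (free_algebra X)"
    have "- p \<in> carrier (free_algebra X)"
      using scale_in_free_algebra[OF p, of "-1"] by (simp add: scale_minus_left)
    then show "\<exists>q\<in>carrier (free_algebra X). q \<oplus>\<^bsub>free_algebra X\<^esub> p = \<zero>\<^bsub>free_algebra X\<^esub>"
      by (intro bexI[of _ "- p"]) (simp_all add: free_algebra_def)
  qed (use keys_add in \<open>fastforce simp: free_algebra_def algebra_simps\<close>)+
  show "monoid (free_algebra X)"
  proof (rule monoidI)
    fix p q assume "p \<in> carrier (free_algebra X)" "q \<in> carrier (free_algebra X)"
    then show "p \<otimes>\<^bsub>free_algebra X\<^esub> q \<in> carrier (free_algebra X)"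
      using keys_mult[of p q] by (fastforce simp: free_algebra_def plus_monom_def)
  qed (simp_all add: free_algebra_def mult.assoc zero_monom_def)
qed (simp_all add: free_algebra_def algebra_simps)

text \<open>This moves computations from the carrier-based sum to the ordinary one. On infinite
  index sets both are 0.\<close>

lemma finsum_free_algebra:
  assumes "\<And>i. i \<in> A \<Longrightarrow> f i \<in> carrier (free_algebra X)"
  shows "(\<Oplus>\<^bsub>free_algebra X\<^esub>i\<in>A. f i) = (\<Sum>i\<in>A. f i)"
proof -
  interpret ring "free_algebra X"
    by (rule ring_free_algebra)
  show ?thesis
    using assms
  proof (induction A rule: infinite_finite_induct)
    case (infinite A)
    then show ?case
      using finsum_infinite[of A f] by (simp add: zero_free_algebra)
  next
    case (insert a A)
    then show ?case
      by (subst finsum_insert) (auto simp: add_free_algebra)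
  qed (simp add: zero_free_algebra)
qed

lemma sum_in_free_algebra:
  assumes "\<And>i. i \<in> A \<Longrightarrow> f i \<in> carrier (free_algebra X)"
  shows "(\<Sum>i\<in>A. f i) \<in> carrier (free_algebra X)"
proof -
  interpret ring "free_algebra X"
    by (rule ring_free_algebra)
  show ?thesis
    using finsum_free_algebra[of A f X] finsum_closed[of f A] assms by (simp add: Pi_def)
qed

section \<open>Ideal membership and computation with cosets\<close>

locale free_algebra_ideal =
  fixes X :: "'a set" and I
  assumes ideal: "ideal I (free_algebra X)"
begin

sublocale ideal I "free_algebra X"
  by (rule ideal)

lemma zero_mem: "0 \<in> I"
  using additive_subgroup.zero_closed[OF is_additive_subgroup] by (simp add: free_algebra_def)

lemma add_mem: "p \<in> I \<Longrightarrow> q \<in> I \<Longrightarrow> p + q \<in> I"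
  using additive_subgroup.a_closed[OF is_additive_subgroup] by (simp add: free_algebra_def)

lemma mult_left_mem: "p \<in> carrier (free_algebra X) \<Longrightarrow> q \<in> I \<Longrightarrow> p * q \<in> I"
  using I_l_closed by (simp add: free_algebra_def)

text \<open>A ring ideal absorbs scalars because the constant \<open>scale c 1\<close> belongs to
  the algebra.\<close>

lemma scale_mem:
  assumes "p \<in> I"
  shows "scale c p \<in> I"
proof -
  have "scale c 1 \<in> carrier (free_algebra X)"
    by (rule scale_in_free_algebra) (simp add: free_algebra_def zero_monom_def)
  from mult_left_mem[OF this assms] show ?thesis
    by (simp add: scale_def)
qed

lemma diff_mem: "p \<in> I \<Longrightarrow> q \<in> I \<Longrightarrow> p - q \<in> I"
  using add_mem[of p "scale (-1) q"] scale_mem[of q "-1"] by (simp add: scale_minus_left)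

lemma sum_mem: "(\<And>i. i \<in> A \<Longrightarrow> f i \<in> I) \<Longrightarrow> (\<Sum>i\<in>A. f i) \<in> I"
  by (induction A rule: infinite_finite_induct) (simp_all add: zero_mem add_mem)

lemma coset_eqI:
  assumes "p \<in> carrier (free_algebra X)" "q \<in> carrier (free_algebra X)" "p - q \<in> I"
  shows "I +>\<^bsub>free_algebra X\<^esub> p = I +>\<^bsub>free_algebra X\<^esub> q"
proof -
  have "p = (p - q) \<oplus>\<^bsub>free_algebra X\<^esub> q"
    by (simp add: free_algebra_def)
  then have "p \<in> I +>\<^bsub>free_algebra X\<^esub> q"
    using assms(3) unfolding a_r_coset_def' by blast
  then show ?thesis
    using a_repr_independence assms(2) a_subgroup by metis
qed

lemma mult_coset:
  assumes "p \<in> carrier (free_algebra X)" "q \<in> carrier (free_algebra X)"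
  shows "(I +>\<^bsub>free_algebra X\<^esub> p) \<otimes>\<^bsub>quot_algebra (free_algebra X) I\<^esub> (I +>\<^bsub>free_algebra X\<^esub> q) =
    I +>\<^bsub>free_algebra X\<^esub> (p * q)"
  using rcoset_mult_add[OF assms] by (simp add: quot_algebra_def ring.defs FactRing_def free_algebra_def)

text \<open>The quotient's scalar multiplication is a union over all representatives; these differ
  by elements of the ideal, so all cosets in the union coincide.\<close>

lemma smult_coset:
  assumes p: "p \<in> carrier (free_algebra X)"
  shows "c \<odot>\<^bsub>quot_algebra (free_algebra X) I\<^esub> (I +>\<^bsub>free_algebra X\<^esub> p) =
    I +>\<^bsub>free_algebra X\<^esub> scale c p"
proof -
  have "I +>\<^bsub>free_algebra X\<^esub> scale c q = I +>\<^bsub>free_algebra X\<^esub> scale c p"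
    if q: "q \<in> I +>\<^bsub>free_algebra X\<^esub> p" for q
  proof -
    obtain h where h: "h \<in> I" "q = h + p"
      using q unfolding a_r_coset_def' add_free_algebra by auto
    then have "q \<in> carrier (free_algebra X)"
      using p a_closed[of h p] Icarr by (simp add: add_free_algebra)
    moreover have "scale c q - scale c p \<in> I"
      using h scale_mem by (simp add: scale_add_right)
    ultimately show ?thesis
      using p by (intro coset_eqI scale_in_free_algebra)
  qed
  moreover have "p \<in> I +>\<^bsub>free_algebra X\<^esub> p"
    using a_rcos_self[OF p] .
  ultimately have "(\<Union>q\<in>I +>\<^bsub>free_algebra X\<^esub> p. I +>\<^bsub>free_algebra X\<^esub> scale c q) =
      I +>\<^bsub>free_algebra X\<^esub> scale c p"
    by blast
  then show ?thesis
    by (simp add: quot_algebra_def ring.defs module.defs smult_free_algebra)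
qed

text \<open>The coset map is a ring homomorphism, so it commutes with sums.
  \<open>quot_algebra\<close> only adds scalars to the quotient ring, which \<open>finsum\<close>
  does not see.\<close>

lemma finsum_coset:
  assumes f: "\<And>i. i \<in> A \<Longrightarrow> f i \<in> carrier (free_algebra X)"
    and g: "\<And>i. i \<in> A \<Longrightarrow> g i = I +>\<^bsub>free_algebra X\<^esub> f i"
  shows "(\<Oplus>\<^bsub>quot_algebra (free_algebra X) I\<^esub>i\<in>A. g i) = I +>\<^bsub>free_algebra X\<^esub> (\<Sum>i\<in>A. f i)"
proof -
  interpret hom: ring_hom_ring "free_algebra X" "free_algebra X Quot I" "(+>\<^bsub>free_algebra X\<^esub>) I"
    by (rule rcos_ring_hom_ring)
  have "finsum (quot_algebra (free_algebra X) I) g A = finsum (free_algebra X Quot I) g A"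
    by (simp add: finsum_def finprod_def quot_algebra_def ring.defs)
  also have "\<dots> = (\<Oplus>\<^bsub>free_algebra X Quot I\<^esub>i\<in>A. I +>\<^bsub>free_algebra X\<^esub> f i)"
    using f g hom.hom_closed by (intro hom.S.finsum_cong') auto
  also have "\<dots> = I +>\<^bsub>free_algebra X\<^esub> (\<Oplus>\<^bsub>free_algebra X\<^esub>i\<in>A. f i)"
    using hom.hom_finsum[of f A] f by (simp add: comp_def Pi_def)
  finally show ?thesis
    using finsum_free_algebra[of A f X] f by simp
qed

end

section \<open>Commutation of the Dunkl elements\<close>

lemma sum_cyclic_shift:
  fixes g :: "nat \<Rightarrow> 'a::comm_monoid_add"
  assumes "i < m"
  shows "(\<Sum>k<m. g ((i + k) mod m)) = (\<Sum>j<m. g j)"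
proof (rule sum.reindex_bij_witness[of _ "\<lambda>j. (j + m - i) mod m" "\<lambda>k. (i + k) mod m"])
  fix k assume "k \<in> {..<m}"
  then show "((i + k) mod m + m - i) mod m = k"
    using assms by (cases "i + k < m") (auto simp: le_mod_geq)
next
  fix j assume "j \<in> {..<m}"
  then show "(i + (j + m - i) mod m) mod m = j"
    using assms by (simp add: mod_add_right_eq)
qed (use assms in auto)

text \<open>The conditions are symmetric under reversal, as a cone does not depend on the order of
  its generators. Reversed sequences supply the relations with shift above
  \<open>m / 2\<close>.\<close>

lemma (in coxeter_matrix) admissible_seq_rev:
  assumes "admissible_seq W S m \<gamma>"
  shows "admissible_seq W S m (\<lambda>i. \<gamma> (m - Suc i))"
proof -
  have "(\<lambda>i. m - Suc i) ` {..<m} = {..<m}"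
  proof (intro equalityI subsetI)
    fix j assume "j \<in> {..<m}"
    then show "j \<in> (\<lambda>i. m - Suc i) ` {..<m}"
      by (intro image_eqI[of _ _ "m - Suc j"]) auto
  qed auto
  then have image: "(\<lambda>i. f (m - Suc i)) ` {..<m} = f ` {..<m}" for f :: "nat \<Rightarrow> 'w \<Rightarrow> real"
    by (metis image_image)
  have swap: "cone2 u v = cone2 v u" for u v :: "'w \<Rightarrow> real"
    unfolding cone2_def by (subst add.commute) blast
  have "cone2 (\<gamma> (m - Suc i)) (\<gamma> (m - Suc (i + 1))) \<inter> pos_roots W S = {\<gamma> (m - Suc i), \<gamma> (m - Suc (i + 1))}"
    if "i + 2 \<le> m" for i
  proof -
    have "m - Suc i = m - Suc (i + 1) + 1" "m - Suc (i + 1) + 2 \<le> m"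
      using that by auto
    then show ?thesis
      using assms unfolding admissible_seq_def by (metis swap insert_commute)
  qed
  moreover have "\<gamma> (m - Suc i) \<in> pos_roots W S" if "i < m" for i
    using assms that by (simp add: admissible_seq_def)
  ultimately show ?thesis
    using assms unfolding admissible_seq_def image[of \<gamma>] image[of "\<lambda>i. - \<gamma> i"] by auto
qed

section \<open>The quadratic relations and the commutator in one plane\<close>

context coxeter_matrix
begin

lemma admissible_seq_root: "admissible_seq W S m \<gamma> \<Longrightarrow> i < m \<Longrightarrow> \<gamma> i \<in> roots W S"
  by (simp add: admissible_seq_def pos_roots_def)

lemma ext_seq_root:
  assumes "admissible_seq W S m \<gamma>"
  shows "ext_seq m \<gamma> i \<in> roots W S"
proof -
  have "i mod m < m"
    using assms by (simp add: admissible_seq_def)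
  then show ?thesis
    using admissible_seq_root[OF assms] by (simp add: ext_seq_def uminus_root)
qed

lemma bracket_relators_subset: "bracket_relators W S \<subseteq> carrier (free_algebra (roots W S))"
proof
  interpret ring "free_algebra (roots W S)"
    by (rule ring_free_algebra)
  have add: "p + q \<in> carrier (free_algebra (roots W S))"
    if "p \<in> carrier (free_algebra (roots W S))" "q \<in> carrier (free_algebra (roots W S))" for p q
    using a_closed[OF that] by (simp add: add_free_algebra)
  fix p assume "p \<in> bracket_relators W S"
  then show "p \<in> carrier (free_algebra (roots W S))"
  proof cases
    case (neg \<gamma>)
    then show ?thesis
      by (auto intro!: add word_in_free_algebra uminus_root)
  next
    case (square \<gamma>)
    then show ?thesis
      by (auto intro!: word_in_free_algebra)
  next
    case (quadratic m \<gamma> k)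
    then show ?thesis
      by (auto intro!: sum_in_free_algebra word_in_free_algebra ext_seq_root)
  next
    case (higher m \<gamma> k)
    then have "\<gamma> i \<in> roots W S" if "i \<le> 2 * k" for i
      using that by (intro admissible_seq_root[of m]) auto
    then show ?thesis
      unfolding higher(1) by (intro add word_in_free_algebra) auto
  qed
qed

sublocale bracket: free_algebra_ideal "roots W S" "bracket_ideal W S"
  unfolding free_algebra_ideal_def bracket_ideal_def
  by (rule ring.genideal_ideal[OF ring_free_algebra bracket_relators_subset])

lemma bracket_relator_mem: "p \<in> bracket_relators W S \<Longrightarrow> p \<in> bracket_ideal W S"
  using ring.genideal_self[OF ring_free_algebra bracket_relators_subset]
  unfolding bracket_ideal_def by blast

lemma word_uminus_mem:
  assumes "a \<in> roots W S" "b \<in> roots W S"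
  shows "word [a, - b] + word [a, b] \<in> bracket_ideal W S"
proof -
  have "word [a] * (word [- b] + word [b]) \<in> bracket_ideal W S"
    using assms by (intro bracket.mult_left_mem word_in_free_algebra bracket_relator_mem
      bracket_relators.neg) auto
  then show ?thesis
    by (simp add: distrib_left flip: word_append)
qed

text \<open>The quadratic relator with the signs of \<open>ext_seq\<close> pulled out of the
  brackets. It is congruent to that relator modulo the relations for negative roots.\<close>

definition cyclic_sum :: "nat \<Rightarrow> (nat \<Rightarrow> 'w \<Rightarrow> real) \<Rightarrow> nat \<Rightarrow> ('w \<Rightarrow> real) monom \<Rightarrow>\<^sub>0 real" where
  "cyclic_sum m \<gamma> k = (\<Sum>i<m. if i + k < m then word [\<gamma> i, \<gamma> ((i + k) mod m)]
     else - word [\<gamma> i, \<gamma> ((i + k) mod m)])"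

lemma cyclic_sum_mem_half:
  assumes "admissible_seq W S m \<gamma>" "1 \<le> k" "2 * k \<le> m"
  shows "cyclic_sum m \<gamma> k \<in> bracket_ideal W S"
proof -
  let ?R = "\<Sum>i<m. word [ext_seq m \<gamma> i, ext_seq m \<gamma> (i + k)]"
  have "?R - cyclic_sum m \<gamma> k \<in> bracket_ideal W S"
    unfolding cyclic_sum_def sum_subtractf[symmetric]
  proof (rule bracket.sum_mem)
    fix i assume "i \<in> {..<m}"
    then have i: "i < m" "(i + k) mod m < m"
      by auto
    show "word [ext_seq m \<gamma> i, ext_seq m \<gamma> (i + k)] - (if i + k < m then word [\<gamma> i, \<gamma> ((i + k) mod m)]
       else - word [\<gamma> i, \<gamma> ((i + k) mod m)]) \<in> bracket_ideal W S"
    proof (cases "i + k < m")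
      case True
      then show ?thesis
        using i by (simp add: ext_seq_def bracket.zero_mem)
    next
      case False
      then have "(i + k) div m = 1"
        using i assms by (simp add: div_nat_eqI)
      then show ?thesis
        using False i assms(1)
        by (simp add: ext_seq_def word_uminus_mem admissible_seq_root)
    qed
  qed
  moreover have "?R \<in> bracket_ideal W S"
    using assms by (intro bracket_relator_mem bracket_relators.quadratic)
  ultimately have "?R - (?R - cyclic_sum m \<gamma> k) \<in> bracket_ideal W S"
    using bracket.diff_mem by blast
  then show ?thesis
    by simp
qed

text \<open>Reversing the order of summation gives the same words, but an index wraps around for
  shift \<open>m - k\<close> in the reversed sequence exactly when it does not for shift
  \<open>k\<close>. Hence every sign flips.\<close>

lemma cyclic_sum_rev:
  assumes "1 \<le> k" "k < m"
  shows "cyclic_sum m (\<lambda>i. \<gamma> (m - Suc i)) (m - k) = - cyclic_sum m \<gamma> k"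
proof -
  define f where "f i = (if i + (m - k) < m
      then word [\<gamma> (m - Suc i), \<gamma> (m - Suc ((i + (m - k)) mod m))]
      else - word [\<gamma> (m - Suc i), \<gamma> (m - Suc ((i + (m - k)) mod m))])" for i
  have f: "f (m - Suc i) = - (if i + k < m then word [\<gamma> i, \<gamma> ((i + k) mod m)]
      else - word [\<gamma> i, \<gamma> ((i + k) mod m)])" if i: "i < m" for i
  proof (cases "i + k < m")
    case True
    then have "m - Suc ((m - Suc i + (m - k)) mod m) = i + k" "(i + k) mod m = i + k"
      "m - Suc (m - Suc i) = i" "\<not> m - Suc i + (m - k) < m"
      using assms by (auto simp: le_mod_geq)
    with True show ?thesis
      unfolding f_def by (simp only: if_True if_False)
  next
    case False
    then have "m - Suc ((m - Suc i + (m - k)) mod m) = i + k - m" "(i + k) mod m = i + k - m"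
      "m - Suc (m - Suc i) = i" "m - Suc i + (m - k) < m"
      using assms i by (auto simp: le_mod_geq)
    with False show ?thesis
      unfolding f_def by (simp only: if_True if_False minus_minus)
  qed
  have "cyclic_sum m (\<lambda>i. \<gamma> (m - Suc i)) (m - k) = (\<Sum>i<m. f i)"
    by (simp add: cyclic_sum_def f_def)
  also have "\<dots> = (\<Sum>i<m. f (m - Suc i))"
    by (rule sum.nat_diff_reindex[symmetric])
  also have "\<dots> = - cyclic_sum m \<gamma> k"
    unfolding cyclic_sum_def sum_negf[symmetric] by (rule sum.cong) (auto simp: f)
  finally show ?thesis .
qed

lemma cyclic_sum_mem:
  assumes "admissible_seq W S m \<gamma>" "1 \<le> k" "k < m"
  shows "cyclic_sum m \<gamma> k \<in> bracket_ideal W S"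
proof (cases "2 * k \<le> m")
  case True
  then show ?thesis
    using cyclic_sum_mem_half assms by simp
next
  case False
  then have "cyclic_sum m (\<lambda>i. \<gamma> (m - Suc i)) (m - k) \<in> bracket_ideal W S"
    using assms by (intro cyclic_sum_mem_half admissible_seq_rev) auto
  then have "0 - cyclic_sum m (\<lambda>i. \<gamma> (m - Suc i)) (m - k) \<in> bracket_ideal W S"
    by (intro bracket.diff_mem bracket.zero_mem)
  then show ?thesis
    using assms by (simp add: cyclic_sum_rev)
qed

text \<open>Sort the pairs by \<open>k = j - i\<close> modulo \<open>m\<close>. A wrapped index
  lowers the angle by \<pi> and so changes the sign of the sine, just as in
  \<open>cyclic_sum\<close>. The class \<open>k = 0\<close> has coefficient 0.\<close>

lemma sin_weighted_sum_mem:
  assumes "admissible_seq W S m \<gamma>"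
  shows "(\<Sum>i<m. \<Sum>j<m. scale (sin (real j * (pi / m) - real i * (pi / m))) (word [\<gamma> i, \<gamma> j]))
    \<in> bracket_ideal W S"
proof -
  define \<delta> where "\<delta> = pi / m"
  have m: "m \<ge> 2"
    using assms by (simp add: admissible_seq_def)
  then have m\<delta>: "real m * \<delta> = pi"
    by (simp add: \<delta>_def)
  define f where "f i j = scale (sin (real j * \<delta> - real i * \<delta>)) (word [\<gamma> i, \<gamma> j])" for i j
  have f: "f i ((i + k) mod m) = scale (sin (real k * \<delta>))
      (if i + k < m then word [\<gamma> i, \<gamma> ((i + k) mod m)] else - word [\<gamma> i, \<gamma> ((i + k) mod m)])"
    if "i < m" "k < m" for i k
  proof (cases "i + k < m")
    case True
    then show ?thesis
      by (simp add: f_def distrib_right)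
  next
    case False
    then have "(i + k) mod m = i + k - m"
      using that by (simp add: le_mod_geq)
    then have "real ((i + k) mod m) = real i + real k - real m"
      using False by (simp add: of_nat_diff)
    then have "real ((i + k) mod m) * \<delta> - real i * \<delta> = real k * \<delta> - pi"
      by (simp add: left_diff_distrib distrib_right m\<delta>)
    then have "f i ((i + k) mod m) = scale (- sin (real k * \<delta>)) (word [\<gamma> i, \<gamma> ((i + k) mod m)])"
      unfolding f_def by (simp only: sin_diff cos_pi sin_pi) simp
    then show ?thesis
      using False scale_diff_right[of "sin (real k * \<delta>)" 0 "word [\<gamma> i, \<gamma> ((i + k) mod m)]"]
      by (simp add: scale_minus_left scale_def[of _ 0])
  qed
  have "(\<Sum>i<m. \<Sum>j<m. f i j) = (\<Sum>i<m. \<Sum>k<m. f i ((i + k) mod m))"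
    by (rule sum.cong[OF HOL.refl], rule sum_cyclic_shift[symmetric]) simp
  also have "\<dots> = (\<Sum>k<m. \<Sum>i<m. f i ((i + k) mod m))"
    by (rule sum.swap)
  also have "\<dots> = (\<Sum>k<m. scale (sin (real k * \<delta>)) (cyclic_sum m \<gamma> k))"
    unfolding cyclic_sum_def scale_sum_right by (intro sum.cong) (simp_all add: f)
  also have "\<dots> \<in> bracket_ideal W S"
  proof (rule bracket.sum_mem)
    fix k assume "k \<in> {..<m}"
    then show "scale (sin (real k * \<delta>)) (cyclic_sum m \<gamma> k) \<in> bracket_ideal W S"
      using cyclic_sum_mem[OF assms, of k] bracket.scale_mem bracket.zero_mem by (cases "k = 0") auto
  qed
  finally show ?thesis
    by (simp add: f_def \<delta>_def)
qed

text \<open>The coefficient is a 2 by 2 determinant, the product of the determinant \<open>C\<close>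
  of the pairings of \<open>x\<close>, \<open>y\<close> with \<open>p\<close>, \<open>q\<close> and
  that of the coordinates of the two roots, which is the sine of the angle from the first to the
  second.\<close>

lemma plane_commutator_mem:
  assumes "m \<ge> 2" "orthonormal p q"
    and "admissible_seq W S m (\<lambda>j. circ p q (real j * (pi / real m)))"
    and Q: "Q = (\<lambda>j. circ p q (real j * (pi / real m))) ` {..<m}"
  shows "(\<Sum>a\<in>Q. \<Sum>b\<in>Q. scale (form W S x a * form W S y b - form W S y a * form W S x b) (word [a, b]))
    \<in> bracket_ideal W S"
proof -
  define \<delta> where "\<delta> = pi / real m"
  define \<gamma> where "\<gamma> j = circ p q (real j * \<delta>)" for j
  have inj: "inj_on \<gamma> {..<m}"
  proof (rule inj_onI)
    fix i j assume ij: "i \<in> {..<m}" "j \<in> {..<m}" "\<gamma> i = \<gamma> j"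
    have "cos (real i * \<delta>) = cos (real j * \<delta>)"
      using form_circ[OF assms(2), of "real i * \<delta>" 0] form_circ[OF assms(2), of "real j * \<delta>" 0] ij(3)
      by (simp add: \<gamma>_def)
    moreover have "0 \<le> real k * \<delta> \<and> real k * \<delta> \<le> pi" if "k < m" for k
      using mult_right_mono[of "real k" "real m" \<delta>] that by (simp add: \<delta>_def)
    ultimately have "real i * \<delta> = real j * \<delta>"
      using ij cos_inj_pi by blast
    then show "i = j"
      using assms(1) by (simp add: \<delta>_def)
  qed
  define C where "C = form W S x p * form W S y q - form W S y p * form W S x q"
  have coeff: "form W S x (\<gamma> i) * form W S y (\<gamma> j) - form W S y (\<gamma> i) * form W S x (\<gamma> j) =
      C * sin (real j * \<delta> - real i * \<delta>)" for i j
    by (simp add: \<gamma>_def circ_def form_lincomb_right C_def sin_diff algebra_simps)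
  have "Q = \<gamma> ` {..<m}"
    by (simp add: Q \<gamma>_def \<delta>_def)
  then have "(\<Sum>a\<in>Q. \<Sum>b\<in>Q. scale (form W S x a * form W S y b - form W S y a * form W S x b) (word [a, b])) =
    (\<Sum>i<m. \<Sum>j<m. scale (C * sin (real j * \<delta> - real i * \<delta>)) (word [\<gamma> i, \<gamma> j]))"
    by (simp add: sum.reindex[OF inj] coeff)
  also have "\<dots> = scale C (\<Sum>i<m. \<Sum>j<m. scale (sin (real j * \<delta> - real i * \<delta>)) (word [\<gamma> i, \<gamma> j]))"
    by (simp add: scale_sum_right scale_scale)
  also have "\<dots> \<in> bracket_ideal W S"
    using sin_weighted_sum_mem[OF assms(3)] by (intro bracket.scale_mem) (simp add: \<gamma>_def \<delta>_def)
  finally show ?thesis .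
qed

text \<open>The change of basis has determinant \<open>D\<close>, and \<open>D = 0\<close> would
  force \<open>a = 0\<close> by independence. Consequently two distinct positive roots determine
  their plane.\<close>

lemma span_eq_span:
  assumes ab: "a \<in> roots W S" "b \<in> roots W S" "a \<noteq> b" "a \<noteq> - b"
    and "a \<in> {lincomb x u y v |x y. True}" "b \<in> {lincomb x u y v |x y. True}"
  shows "{lincomb x a y b |x y. True} = {lincomb x u y v |x y. True}"
proof -
  obtain x y x' y' where a: "a = lincomb x u y v" and b: "b = lincomb x' u y' v"
    using assms by blast
  define D where "D = x * y' - x' * y"
  have D_u: "lincomb y' a (- y) b = lincomb D u 0 v" and D_v: "lincomb (- x') a x b = lincomb 0 u D v"
    by (auto simp: a b D_def fun_eq_iff lincomb_apply algebra_simps)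
  have "D \<noteq> 0"
  proof
    assume "D = 0"
    then have "lincomb y' a (- y) b = lincomb 0 a 0 b" "lincomb (- x') a x b = lincomb 0 a 0 b"
      using D_u D_v by (auto simp: fun_eq_iff lincomb_apply)
    then have "x = 0" "y = 0"
      using roots_independent[OF ab] by fastforce+
    then have "form W S a a = 0"
      by (simp add: a form_lincomb_left)
    then show False
      using ab by (simp add: form_root_self)
  qed
  have uv: "lincomb r u s v = lincomb (r * y' / D - s * x' / D) a (s * x / D - r * y / D) b" for r s
  proof
    fix t
    have u: "u t = (y' * a t - y * b t) / D" and v: "v t = (x * b t - x' * a t) / D"
      using fun_cong[OF D_u, of t] fun_cong[OF D_v, of t] \<open>D \<noteq> 0\<close>
      by (auto simp: lincomb_apply field_simps)
    show "lincomb r u s v t = lincomb (r * y' / D - s * x' / D) a (s * x / D - r * y / D) b t"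
      unfolding lincomb_apply u v by (simp add: algebra_simps diff_divide_distrib)
  qed
  have "lincomb r a s b = lincomb (r * x + s * x') u (r * y + s * y') v" for r s
    by (simp add: a b fun_eq_iff lincomb_apply algebra_simps)
  with uv show ?thesis
    by blast
qed

text \<open>A representative in the free algebra: each Dunkl element is the coset of such a sum for
  a suitable \<open>x\<close>.\<close>

definition dunkl_lift :: "('w \<Rightarrow> real) \<Rightarrow> ('w \<Rightarrow> real) monom \<Rightarrow>\<^sub>0 real" where
  "dunkl_lift x = (\<Sum>\<gamma>\<in>pos_roots W S. scale (form W S x \<gamma>) (word [\<gamma>]))"

lemma dunkl_lift_in_free_algebra: "dunkl_lift x \<in> carrier (free_algebra (roots W S))"
  unfolding dunkl_lift_def
  by (intro sum_in_free_algebra scale_in_free_algebra word_in_free_algebra) (simp add: pos_roots_def)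

text \<open>The commutator is a double sum with coefficients antisymmetric in the two roots, so its
  diagonal vanishes. The remaining pairs are partitioned by the planes they span, and each class
  lies in the ideal.\<close>

lemma dunkl_lift_commutator_mem:
  "dunkl_lift x * dunkl_lift y - dunkl_lift y * dunkl_lift x \<in> bracket_ideal W S"
proof (cases "finite (pos_roots W S)")
  case False
  then show ?thesis
    by (simp add: dunkl_lift_def bracket.zero_mem)
next
  case fin: True
  define g where "g = (\<lambda>(a, b). scale (form W S x a * form W S y b - form W S y a * form W S x b) (word [a, b]))"
  define T where "T = {(a, b). a \<in> pos_roots W S \<and> b \<in> pos_roots W S \<and> a \<noteq> b}"
  \<comment> \<open>A plane is represented by the set of its positive roots.\<close>
  define plane where "plane = (\<lambda>(a, b). pos_roots W S \<inter> {lincomb r a s b |r s. True})"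
  have g_diag: "g (a, a) = 0" for a
    by (simp add: g_def)
  have T_sub: "T \<subseteq> pos_roots W S \<times> pos_roots W S"
    by (auto simp: T_def)
  then have fin_T: "finite T"
    using fin finite_subset by blast
  have fibre: "(\<Sum>z | z \<in> T \<and> plane z = Q. g z) \<in> bracket_ideal W S" if Q: "Q \<in> plane ` T" for Q
  proof -
    obtain u v where uv: "u \<in> pos_roots W S" "v \<in> pos_roots W S" "u \<noteq> v"
      and Q_eq: "Q = pos_roots W S \<inter> {lincomb r u s v |r s. True}"
      using Q by (auto simp: T_def plane_def)
    \<comment> \<open>Any two distinct positive roots of a plane span it, so a class consists of all
      off-diagonal pairs of \<open>Q\<close>; adding the zero diagonal terms makes it a full
      square.\<close>
    have fibre_eq: "{z. z \<in> T \<and> plane z = Q} = {z \<in> Q \<times> Q. fst z \<noteq> snd z}"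
    proof (intro equalityI subsetI)
      fix z assume z: "z \<in> {z. z \<in> T \<and> plane z = Q}"
      obtain a b where ab: "z = (a, b)"
        by (cases z)
      have "a = lincomb 1 a 0 b" "b = lincomb 0 a 1 b"
        by (auto simp: fun_eq_iff lincomb_apply)
      then have "a \<in> plane (a, b)" "b \<in> plane (a, b)"
        using z ab unfolding plane_def T_def by blast+
      then show "z \<in> {z \<in> Q \<times> Q. fst z \<noteq> snd z}"
        using z ab by (auto simp: T_def)
    next
      fix z assume "z \<in> {z \<in> Q \<times> Q. fst z \<noteq> snd z}"
      then obtain a b where ab: "z = (a, b)" "a \<in> Q" "b \<in> Q" "a \<noteq> b"
        by auto
      have pos: "a \<in> pos_roots W S" "b \<in> pos_roots W S"
        using ab Q_eq by auto
      then have "a \<noteq> - b"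
        using uminus_pos_root by auto
      have "{lincomb r a s b |r s. True} = {lincomb r u s v |r s. True}"
        using ab pos pos_roots_subset \<open>a \<noteq> - b\<close> unfolding Q_eq by (intro span_eq_span) blast+
      then show "z \<in> {z. z \<in> T \<and> plane z = Q}"
        using ab pos by (simp add: T_def plane_def Q_eq)
    qed
    have "finite Q"
      using fin Q_eq by simp
    then have "(\<Sum>z | z \<in> T \<and> plane z = Q. g z) = (\<Sum>z\<in>Q \<times> Q. g z)"
      unfolding fibre_eq by (intro sum.mono_neutral_left) (auto simp: g_diag)
    also have "\<dots> = (\<Sum>a\<in>Q. \<Sum>b\<in>Q. g (a, b))"
      by (simp add: sum.cartesian_product)
    also have "\<dots> \<in> bracket_ideal W S"
      unfolding g_def prod.case Q_eq
      by (rule plane_pos_roots[OF fin uv]) (rule plane_commutator_mem)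
    finally show ?thesis .
  qed
  have "dunkl_lift x * dunkl_lift y - dunkl_lift y * dunkl_lift x =
      (\<Sum>a\<in>pos_roots W S. \<Sum>b\<in>pos_roots W S. g (a, b))"
    by (simp add: dunkl_lift_def sum_product scale_word_mult g_def scale_diff_left sum_subtractf)
  also have "\<dots> = (\<Sum>z\<in>pos_roots W S \<times> pos_roots W S. g z)"
    by (simp add: sum.cartesian_product)
  also have "\<dots> = (\<Sum>z\<in>T. g z)"
    using fin by (intro sum.mono_neutral_right) (auto simp: T_def g_diag)
  also have "\<dots> = (\<Sum>Q\<in>plane ` T. \<Sum>z | z \<in> T \<and> plane z = Q. g z)"
    by (rule sum.image_gen[OF fin_T])
  also have "\<dots> \<in> bracket_ideal W S"
    by (rule bracket.sum_mem) (rule fibre)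
  finally show ?thesis .
qed

text \<open>This holds for any value of \<^const>\<open>fund_weight\<close>, even the one that \<open>THE\<close> would take
  on a degenerate form.\<close>

lemma dunkl_eq_coset: "\<exists>x. dunkl W S s = bracket_ideal W S +>\<^bsub>free_algebra (roots W S)\<^esub> dunkl_lift x"
proof -
  define \<omega> where "\<omega> = fund_weight W S"
  \<comment> \<open>Exchanging the sums over \<open>S\<close> and over the positive roots leaves
    this vector in the form; the factor 2 is that of the coroot of a unit vector.\<close>
  define x where "x = (\<lambda>r. \<Sum>t\<in>S. 2 * form W S (simple_root s) (simple_root t) * \<omega> t r)"
  have form_x: "form W S x \<gamma> = (\<Sum>t\<in>S. 2 * form W S (simple_root s) (simple_root t) * form W S (\<omega> t) \<gamma>)"
    for \<gamma>
  proof -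
    have "form W S (\<lambda>r. \<Sum>t\<in>A. c t * \<omega> t r) \<gamma> = (\<Sum>t\<in>A. c t * form W S (\<omega> t) \<gamma>)" for c A
    proof (induction A rule: infinite_finite_induct)
      case (insert t A)
      have "(\<lambda>r. \<Sum>t\<in>insert t A. c t * \<omega> t r) = lincomb (c t) (\<omega> t) 1 (\<lambda>r. \<Sum>t\<in>A. c t * \<omega> t r)"
        using insert by (simp add: fun_eq_iff lincomb_apply)
      then show ?case
        using insert by (simp add: form_lincomb_left)
    qed (simp_all add: form_def)
    then show ?thesis
      by (simp add: x_def)
  qed
  have coroot: "form W S u (coroot W S \<gamma>) = 2 * form W S u \<gamma>" if "\<gamma> \<in> pos_roots W S" for u \<gamma>
  proof -
    have "coroot W S \<gamma> = lincomb 2 \<gamma> 0 \<gamma>"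
      using that by (simp add: coroot_def form_root_self pos_roots_subset fun_eq_iff lincomb_apply)
    then show ?thesis
      by (simp add: form_lincomb_right)
  qed
  let ?F = "free_algebra (roots W S)"
  let ?I = "bracket_ideal W S"
  have word: "word [\<gamma>] \<in> carrier ?F" if "\<gamma> \<in> pos_roots W S" for \<gamma>
    using that by (intro word_in_free_algebra) (simp add: pos_roots_def)
  define c where "c t \<gamma> = form W S (\<omega> t) (coroot W S \<gamma>)" for t \<gamma>
  have in_F: "(\<Sum>\<gamma>\<in>pos_roots W S. scale (c t \<gamma>) (word [\<gamma>])) \<in> carrier ?F" for t
    by (intro sum_in_free_algebra scale_in_free_algebra word)
  have chevalley: "chevalley W S t = ?I +>\<^bsub>?F\<^esub> (\<Sum>\<gamma>\<in>pos_roots W S. scale (c t \<gamma>) (word [\<gamma>]))" for t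
    unfolding chevalley_def bracket_algebra_def
  proof (rule bracket.finsum_coset)
    fix \<gamma> assume "\<gamma> \<in> pos_roots W S"
    then show "scale (c t \<gamma>) (word [\<gamma>]) \<in> carrier ?F"
      by (intro scale_in_free_algebra word)
    show "form W S (fund_weight W S t) (coroot W S \<gamma>) \<odot>\<^bsub>quot_algebra ?F ?I\<^esub> bracket W S \<gamma> =
        ?I +>\<^bsub>?F\<^esub> scale (c t \<gamma>) (word [\<gamma>])"
      unfolding bracket_def c_def \<omega>_def
      by (rule bracket.smult_coset) (rule word, fact)
  qed
  have "dunkl W S s = ?I +>\<^bsub>?F\<^esub> (\<Sum>t\<in>S. scale (form W S (simple_root s) (simple_root t))
      (\<Sum>\<gamma>\<in>pos_roots W S. scale (c t \<gamma>) (word [\<gamma>])))"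
    unfolding dunkl_def bracket_algebra_def
  proof (rule bracket.finsum_coset)
    fix t
    show "scale (form W S (simple_root s) (simple_root t))
        (\<Sum>\<gamma>\<in>pos_roots W S. scale (c t \<gamma>) (word [\<gamma>])) \<in> carrier ?F"
      by (intro scale_in_free_algebra in_F)
    show "form W S (simple_root s) (simple_root t) \<odot>\<^bsub>quot_algebra ?F ?I\<^esub> chevalley W S t =
        ?I +>\<^bsub>?F\<^esub> scale (form W S (simple_root s) (simple_root t))
          (\<Sum>\<gamma>\<in>pos_roots W S. scale (c t \<gamma>) (word [\<gamma>]))"
      unfolding chevalley by (rule bracket.smult_coset) (rule in_F)
  qed
  also have "(\<Sum>t\<in>S. scale (form W S (simple_root s) (simple_root t))
      (\<Sum>\<gamma>\<in>pos_roots W S. scale (c t \<gamma>) (word [\<gamma>]))) =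
    (\<Sum>t\<in>S. \<Sum>\<gamma>\<in>pos_roots W S. scale (form W S (simple_root s) (simple_root t) * c t \<gamma>) (word [\<gamma>]))"
    by (simp add: scale_sum_right scale_scale)
  also have "\<dots> = (\<Sum>\<gamma>\<in>pos_roots W S. \<Sum>t\<in>S. scale (form W S (simple_root s) (simple_root t) * c t \<gamma>) (word [\<gamma>]))"
    by (rule sum.swap)
  also have "\<dots> = dunkl_lift x"
    unfolding dunkl_lift_def form_x scale_sum_left c_def
    by (intro sum.cong HOL.refl) (simp add: coroot algebra_simps)
  finally show ?thesis
    by blast
qed

lemma dunkl_commute:
  "dunkl W S s \<otimes>\<^bsub>bracket_algebra W S\<^esub> dunkl W S t = dunkl W S t \<otimes>\<^bsub>bracket_algebra W S\<^esub> dunkl W S s"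
proof -
  obtain x y where xy: "dunkl W S s = bracket_ideal W S +>\<^bsub>free_algebra (roots W S)\<^esub> dunkl_lift x"
      "dunkl W S t = bracket_ideal W S +>\<^bsub>free_algebra (roots W S)\<^esub> dunkl_lift y"
    using dunkl_eq_coset by blast
  have mult: "dunkl_lift x * dunkl_lift y \<in> carrier (free_algebra (roots W S))" for x y
    using bracket.m_closed[OF dunkl_lift_in_free_algebra dunkl_lift_in_free_algebra]
    by (simp add: free_algebra_def)
  show ?thesis
    unfolding xy bracket_algebra_def bracket.mult_coset[OF dunkl_lift_in_free_algebra dunkl_lift_in_free_algebra]
    by (intro bracket.coset_eqI mult dunkl_lift_commutator_mem)
qed

end

text \<open>Generators are involutions, so \<open>s t = 1\<close> only for \<open>s = t\<close>, and
  the inverse of \<open>s t\<close> is \<open>t s\<close>, which has the same order. Finiteness of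
  the group makes all orders positive.\<close>

lemma coxeter_matrix_of_system:
  assumes "coxeter_system W S" "finite (carrier W)"
  shows "coxeter_matrix W S"
proof
  interpret group W
    using assms by (simp add: coxeter_system_def)
  have S: "S \<subseteq> carrier W" and ord: "\<And>s. s \<in> S \<Longrightarrow> group.ord W s = 2"
    using assms by (auto simp: coxeter_system_def)
  have sq: "s \<otimes>\<^bsub>W\<^esub> s = \<one>\<^bsub>W\<^esub>" if "s \<in> S" for s
    using pow_ord_eq_1[of s] ord[OF that] that S by (auto simp: numeral_2_eq_2)
  then have inv: "inv\<^bsub>W\<^esub> s = s" if "s \<in> S" for s
    using that S inv_unique'[of s s] by auto
  show "finite S"
    using S assms(2) finite_subset by blast
  fix s assume s: "s \<in> S"
  show "coxeter_mat W s s = 1"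
    using sq[OF s] by (simp add: coxeter_mat_def)
  fix t assume t: "t \<in> S"
  have carr: "s \<in> carrier W" "t \<in> carrier W"
    using s t S by auto
  show "coxeter_mat W s t \<ge> 2" if "s \<noteq> t"
  proof -
    have "s \<otimes>\<^bsub>W\<^esub> t \<noteq> \<one>\<^bsub>W\<^esub>"
      using inv_equality[of s t] inv[OF t] that carr by auto
    then have "ord (s \<otimes>\<^bsub>W\<^esub> t) \<noteq> 1"
      using ord_eq_1 carr by auto
    moreover have "ord (s \<otimes>\<^bsub>W\<^esub> t) \<ge> 1"
      using ord_ge_1 assms(2) carr by auto
    ultimately show ?thesis
      by (simp add: coxeter_mat_def)
  qed
  have "inv\<^bsub>W\<^esub> (s \<otimes>\<^bsub>W\<^esub> t) = t \<otimes>\<^bsub>W\<^esub> s"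
    using inv_mult_group carr inv s t by simp
  then show "coxeter_mat W s t = coxeter_mat W t s"
    using ord_inv[of "s \<otimes>\<^bsub>W\<^esub> t"] carr by (simp add: coxeter_mat_def)
qed

theorem theorem4p1:
  fixes W :: "('w, 'r) monoid_scheme" and S :: "'w set"
  assumes "coxeter_system W S" and "finite (carrier W)"
    and "s \<in> S" and "t \<in> S"
  shows "dunkl W S s \<otimes>\<^bsub>bracket_algebra W S\<^esub> dunkl W S t =
         dunkl W S t \<otimes>\<^bsub>bracket_algebra W S\<^esub> dunkl W S s"
  by (rule coxeter_matrix.dunkl_commute) (rule coxeter_matrix_of_system[OF assms(1,2)])

end
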